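(* If $\mathcal G$ is a compactly generated and topologically transitive pseudogroup acting on a Polish space $X$ which has density of periodic orbits, then $\mathcal G$ is sensitive to initial conditions.
   Context: Metrics may take the value $\infty$; a metric is compatible if its open balls generate the topology. $\mathrm{Ph}(X)$ is the set of partial homeomorphisms of $X$, i.e. homeomorphisms $f\colon\mathrm{dom} f\to\mathrm{im} f$ between open subsets of $X$. The composition $gf$ has domain $f^{-1}(\mathrm{dom}\,g)$, and $f(A)$ means $f(A\cap\mathrm{dom} f)$. A pseudo$*$group on $X$ is a subset of $\mathrm{Ph}(X)$ containing $\mathrm{id}_X$ and closed under inversion, composition and restriction to open subsets of domains. A pseudogroup $\mathcal G\curvearrowright X$ is a pseudo$*$group such that if $f\in\mathrm{Ph}(X)$ and every $x\in\mathrm{dom} f$ has an open neighborhood $U_x$ with $f|_{U_x}\in\mathcal G$, then $f\in\mathcal G$. $S\subset\mathcal G$ generates $\mathcal G$ if $\mathcal G$ is the smallest pseudogroup containing $S$. The orbit of $x$ is $\mathcal Gx=\{gx\mid g\in\mathcal G,\ x\in\mathrm{dom}\,g\}$. For open $U\subset X$, $\mathcal G|_U=\{f\in\mathcal G\mid\mathrm{dom} f,\mathrm{im} f\subset U\}$, a pseudogroup on $U$. $\mathcal G$ is compactly generated if there is a triple $(U,F,\widetilde F)$ where $U\subset X$ is a relatively compact open set meeting every $\mathcal G$-orbit; $F\subset\mathcal G|_U$ and $\widetilde F\subset\mathcal G$ are finite and symmetric (closed under inversion); $F$ generates $\mathcal G|_U$; and there is a bijection $F\to\widetilde F$, $f\mapsto\tilde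 f$, such that $\tilde f$ extends $f$ and $\overline{\mathrm{dom} f}\subset\mathrm{dom}\,\tilde f$ for every $f\in F$. $\mathcal G$ is topologically transitive if for all non-empty open $U,V\subset X$ there is $g\in\mathcal G$ with $g(U)\cap V\ne\emptyset$. $\mathcal G$ has density of periodic orbits if there is an open $U\subset X$ meeting every $\mathcal G$-orbit such that the union of the finite $\mathcal G|_U$-orbits is dense in $U$. $\mathcal G$ is sensitive to initial conditions if for every compatible metric $d$ on $X$ and every pseudo$*$group $\mathcal S\subset\mathcal G$ generating $\mathcal G$ there is $c>0$ such that for every $x\in X$ and $r>0$ there are $s\in\mathcal S$ and $y$ with $x,y\in\mathrm{dom}\,s$, $d(x,y)<r$ and $d(sx,sy)\ge c$.
   Formalization: The formal theorem assumes in addition that X, if non-empty, is not discrete; without this the claim fails (e.g. a one-point space with its pseudogroup of all partial homeomorphisms), and sensitivity is always false on non-empty discrete spaces. *)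

theory Defs
  imports "HOL-Analysis.Analysis"
begin

text \<open>A partial map of \<^term>\<open>X\<close> is represented by a map \<^typ>\<open>'a \<rightharpoonup> 'a\<close>, so that two partial maps
  are equal iff they have the same domain and the same values. The image of \<^term>\<open>f\<close> is
  \<^term>\<open>ran f\<close>; \<^term>\<open>g \<circ>\<^sub>m f\<close> has domain \<open>f\<inverse>(dom g)\<close>; \<^term>\<open>f |` A\<close> is the
  restriction of \<^term>\<open>f\<close> to \<open>A \<inter> dom f\<close>, and \<^term>\<open>ran (f |` A)\<close> is \<open>f(A \<inter> dom f)\<close>.\<close>

definition partial_homeos :: "'a topology \<Rightarrow> ('a \<rightharpoonup> 'a) set" where
  "partial_homeos X = {f. openin X (dom f) \<and> openin X (ran f) \<and>
     homeomorphic_map (subtopology X (dom f)) (subtopology X (ran f)) (\<lambda>x. the (f x))}"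

definition map_id_on :: "'a set \<Rightarrow> 'a \<rightharpoonup> 'a" where
  "map_id_on A = Some |` A"

text \<open>Only meaningful for injective \<^term>\<open>f\<close>, in particular for partial homeomorphisms.\<close>

definition map_inverse :: "('a \<rightharpoonup> 'b) \<Rightarrow> 'b \<rightharpoonup> 'a" where
  "map_inverse f = (\<lambda>y. if y \<in> ran f then Some (THE x. f x = Some y) else None)"

definition pseudo_star_group :: "'a topology \<Rightarrow> ('a \<rightharpoonup> 'a) set \<Rightarrow> bool" where
  "pseudo_star_group X G \<longleftrightarrow>
     G \<subseteq> partial_homeos X \<and>
     map_id_on (topspace X) \<in> G \<and>
     (\<forall>f\<in>G. map_inverse f \<in> G) \<and>
     (\<forall>f\<in>G. \<forall>g\<in>G. g \<circ>\<^sub>m f \<in> G) \<and>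
     (\<forall>f\<in>G. \<forall>V. openin X V \<and> V \<subseteq> dom f \<longrightarrow> f |` V \<in> G)"

definition pseudogroup :: "'a topology \<Rightarrow> ('a \<rightharpoonup> 'a) set \<Rightarrow> bool" where
  "pseudogroup X G \<longleftrightarrow>
     pseudo_star_group X G \<and>
     (\<forall>f\<in>partial_homeos X.
        (\<forall>x\<in>dom f. \<exists>V. openin X V \<and> x \<in> V \<and> V \<subseteq> dom f \<and> f |` V \<in> G) \<longrightarrow> f \<in> G)"

definition generates :: "'a topology \<Rightarrow> ('a \<rightharpoonup> 'a) set \<Rightarrow> ('a \<rightharpoonup> 'a) set \<Rightarrow> bool" where
  "generates X S G \<longleftrightarrow>
     pseudogroup X G \<and> S \<subseteq> G \<and> (\<forall>H. pseudogroup X H \<and> S \<subseteq> H \<longrightarrow> G \<subseteq> H)"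

definition orbit_of :: "('a \<rightharpoonup> 'a) set \<Rightarrow> 'a \<Rightarrow> 'a set" where
  "orbit_of G x = {y. \<exists>g\<in>G. g x = Some y}"

definition meets_every_orbit :: "'a topology \<Rightarrow> ('a \<rightharpoonup> 'a) set \<Rightarrow> 'a set \<Rightarrow> bool" where
  "meets_every_orbit X G U \<longleftrightarrow> (\<forall>x\<in>topspace X. orbit_of G x \<inter> U \<noteq> {})"

text \<open>For open \<^term>\<open>U\<close> this is a pseudogroup on \<^term>\<open>subtopology X U\<close>.\<close>

definition restrict_pseudogroup :: "('a \<rightharpoonup> 'a) set \<Rightarrow> 'a set \<Rightarrow> ('a \<rightharpoonup> 'a) set" where
  "restrict_pseudogroup G U = {f \<in> G. dom f \<subseteq> U \<and> ran f \<subseteq> U}"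

definition symmetric_maps :: "('a \<rightharpoonup> 'a) set \<Rightarrow> bool" where
  "symmetric_maps F \<longleftrightarrow> (\<forall>f\<in>F. map_inverse f \<in> F)"

definition compactly_generated :: "'a topology \<Rightarrow> ('a \<rightharpoonup> 'a) set \<Rightarrow> bool" where
  "compactly_generated X G \<longleftrightarrow>
     (\<exists>U F F'.
        openin X U \<and> compactin X (X closure_of U) \<and> meets_every_orbit X G U \<and>
        F \<subseteq> restrict_pseudogroup G U \<and> finite F \<and> symmetric_maps F \<and>
        F' \<subseteq> G \<and> finite F' \<and> symmetric_maps F' \<and>
        generates (subtopology X U) F (restrict_pseudogroup G U) \<and>
        (\<exists>\<phi>. bij_betw \<phi> F F' \<and>
             (\<forall>f\<in>F. f \<subseteq>\<^sub>m \<phi> f \<and> X closure_of (dom f) \<subseteq> dom (\<phi> f))))"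

definition topologically_transitive :: "'a topology \<Rightarrow> ('a \<rightharpoonup> 'a) set \<Rightarrow> bool" where
  "topologically_transitive X G \<longleftrightarrow>
     (\<forall>U V. openin X U \<and> U \<noteq> {} \<and> openin X V \<and> V \<noteq> {} \<longrightarrow>
        (\<exists>g\<in>G. ran (g |` U) \<inter> V \<noteq> {}))"

definition density_of_periodic_orbits :: "'a topology \<Rightarrow> ('a \<rightharpoonup> 'a) set \<Rightarrow> bool" where
  "density_of_periodic_orbits X G \<longleftrightarrow>
     (\<exists>U. openin X U \<and> meets_every_orbit X G U \<and>
        subtopology X U closure_of
          \<Union>{orbit_of (restrict_pseudogroup G U) x | x.
               x \<in> U \<and> finite (orbit_of (restrict_pseudogroup G U) x)} = U)"

text \<open>Metrics may take the value \<^term>\<open>\<infinity>\<close>, hence the codomain \<^typ>\<open>ennreal\<close>.\<close>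

definition extended_metric_on :: "'a set \<Rightarrow> ('a \<Rightarrow> 'a \<Rightarrow> ennreal) \<Rightarrow> bool" where
  "extended_metric_on M d \<longleftrightarrow>
     (\<forall>x\<in>M. \<forall>y\<in>M. d x y = 0 \<longleftrightarrow> x = y) \<and>
     (\<forall>x\<in>M. \<forall>y\<in>M. d x y = d y x) \<and>
     (\<forall>x\<in>M. \<forall>y\<in>M. \<forall>z\<in>M. d x z \<le> d x y + d y z)"

definition compatible_metric :: "'a topology \<Rightarrow> ('a \<Rightarrow> 'a \<Rightarrow> ennreal) \<Rightarrow> bool" where
  "compatible_metric X d \<longleftrightarrow>
     extended_metric_on (topspace X) d \<and>
     X = topology_generated_by
           {{y \<in> topspace X. d x y < ennreal r} | x r. x \<in> topspace X \<and> 0 < r}"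

definition sensitive_to_initial_conditions :: "'a topology \<Rightarrow> ('a \<rightharpoonup> 'a) set \<Rightarrow> bool" where
  "sensitive_to_initial_conditions X G \<longleftrightarrow>
     (\<forall>d S. compatible_metric X d \<and> pseudo_star_group X S \<and> S \<subseteq> G \<and> generates X S G \<longrightarrow>
        (\<exists>c::real. 0 < c \<and>
           (\<forall>x\<in>topspace X. \<forall>r::real. 0 < r \<longrightarrow>
              (\<exists>s\<in>S. \<exists>y. x \<in> dom s \<and> y \<in> dom s \<and> d x y < ennreal r \<and>
                 ennreal c \<le> d (the (s x)) (the (s y))))))"

definition polish_topology :: "'a topology \<Rightarrow> bool" where
  "polish_topology X \<longleftrightarrow> completely_metrizable_space X \<and> separable_space X"

text \<open>On a non-empty discrete space sensitivity always fails, because the only point within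
  distance \<open>r\<close> of \<open>x\<close> may be \<open>x\<close> itself. The pseudogroup of all partial homeomorphisms of a
  one-point space nevertheless is compactly generated and topologically transitive and has
  density of periodic orbits, so non-discreteness has to be assumed separately.\<close>

lemma discrete_not_sensitive:
  assumes G: "pseudogroup X G" and disc: "X = discrete_topology (topspace X)"
    and ne: "topspace X \<noteq> {}"
  shows "\<not> sensitive_to_initial_conditions X G"
proof
  assume sens: "sensitive_to_initial_conditions X G"
  define d :: "'a \<Rightarrow> 'a \<Rightarrow> ennreal" where "d = (\<lambda>x y. if x = y then 0 else 1)"
  have ext: "extended_metric_on (topspace X) d"
    by (auto simp: extended_metric_on_def d_def)
  let ?B = "{{y \<in> topspace X. d x y < ennreal r} | x r. x \<in> topspace X \<and> 0 < r}"
  have opn: "openin (topology_generated_by ?B) {x}" if "x \<in> topspace X" for x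
  proof -
    have "{x} = {y \<in> topspace X. d x y < ennreal 1}"
      using that by (auto simp: d_def)
    then have "{x} \<in> ?B"
      unfolding mem_Collect_eq using that by (intro exI[of _ x] exI[of _ "1::real"]) simp
    then show ?thesis by (rule topology_generated_by_Basis)
  qed
  have top: "topspace (topology_generated_by ?B) = topspace X"
    using opn openin_subset by (fastforce simp: topology_generated_by_topspace)
  have "topology_generated_by ?B = discrete_topology (topspace X)"
    by (rule iffD2[OF discrete_topology_unique, symmetric]) (intro conjI ballI top opn)
  then have comp: "compatible_metric X d"
    using ext disc unfolding compatible_metric_def by simp
  have gen: "pseudo_star_group X G" "generates X G G"
    using G by (auto simp: generates_def pseudogroup_def)
  have "\<exists>c::real. 0 < c \<and> (\<forall>x\<in>topspace X. \<forall>r::real. 0 < r \<longrightarrow>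
      (\<exists>s\<in>G. \<exists>y. x \<in> dom s \<and> y \<in> dom s \<and> d x y < ennreal r \<and> ennreal c \<le> d (the (s x)) (the (s y))))"
    using sens[unfolded sensitive_to_initial_conditions_def, rule_format, of d G] comp gen
    by simp
  then obtain c :: real where c: "0 < c" and
    P: "\<forall>x\<in>topspace X. \<forall>r::real. 0 < r \<longrightarrow>
      (\<exists>s\<in>G. \<exists>y. x \<in> dom s \<and> y \<in> dom s \<and> d x y < ennreal r \<and> ennreal c \<le> d (the (s x)) (the (s y)))"
    by (elim exE conjE)
  obtain x where "x \<in> topspace X" using ne by blast
  from P[rule_format, OF this zero_less_one]
  obtain s y where "d x y < 1" "ennreal c \<le> d (the (s x)) (the (s y))"
    by auto
  then show False using c by (auto simp: d_def split: if_splits)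
qed

lemma one_point_pseudogroup:
  fixes a :: 'a
  defines "X \<equiv> discrete_topology {a}" and "G \<equiv> {map_id_on {a}, Map.empty}"
  shows "polish_topology X" "pseudogroup X G" "compactly_generated X G"
    "topologically_transitive X G" "density_of_periodic_orbits X G"
proof -
  let ?i = "map_id_on {a}"
  have i: "?i x = (if x = a then Some a else None)" for x
    by (auto simp: map_id_on_def restrict_map_def)
  have di: "dom ?i = {a}" "ran ?i = {a}"
    by (auto simp: i dom_def ran_def)
  show "polish_topology X"
    by (simp add: polish_topology_def X_def completely_metrizable_space_discrete_topology
        separable_space_def) (rule exI[of _ "{a}"], use closure_of_topspace[of "discrete_topology {a}"] in simp)
  have invi: "map_inverse ?i = ?i" "map_inverse Map.empty = (Map.empty :: 'a \<rightharpoonup> 'a)"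
    by (auto simp: map_inverse_def di i fun_eq_iff)
  have sub: "G = partial_homeos X"
  proof -
    have "?i \<in> partial_homeos X"
    proof -
      have "homeomorphic_maps X X (\<lambda>x. the (?i x)) (\<lambda>x. a)"
        by (simp add: homeomorphic_maps_def X_def i)
      then show ?thesis
        by (auto simp: partial_homeos_def di homeomorphic_map_maps X_def)
    qed
    moreover have "Map.empty \<in> partial_homeos X"
      by (simp add: partial_homeos_def homeomorphic_map_def quotient_map_def)
    moreover have "f \<in> G" if f: "f \<in> partial_homeos X" for f
    proof -
      have "dom f \<subseteq> {a}" "ran f \<subseteq> {a}" using f by (auto simp: partial_homeos_def X_def)
      moreover have "f a = None \<or> f a = Some a"
        using calculation(2) by (cases "f a") (auto simp: ran_def)
      ultimately have "f = Map.empty \<or> f = ?i"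
        unfolding fun_eq_iff i by (auto simp: subset_iff domIff)
      then show ?thesis by (auto simp: G_def)
    qed
    ultimately show ?thesis by (auto simp: G_def)
  qed
  have ps: "pseudo_star_group X G"
    unfolding pseudo_star_group_def
  proof (intro conjI ballI allI impI)
    show "G \<subseteq> partial_homeos X" using sub by simp
    show "map_id_on (topspace X) \<in> G" by (simp add: X_def G_def)
    show "map_inverse f \<in> G" if "f \<in> G" for f using that invi by (auto simp: G_def)
    show "g \<circ>\<^sub>m f \<in> G" if "f \<in> G" "g \<in> G" for f g
    proof -
      have "?i \<circ>\<^sub>m ?i = ?i" by (auto simp: map_comp_def i fun_eq_iff)
      moreover have "Map.empty \<circ>\<^sub>m ?i = Map.empty" by (auto simp: map_comp_def i fun_eq_iff)
      ultimately show ?thesis using that by (auto simp: G_def)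
    qed
    show "f |` V \<in> G" if "f \<in> G" "openin X V \<and> V \<subseteq> dom f" for f V
    proof -
      have "V = {} \<or> V = {a}" using that by (auto simp: X_def)
      moreover have "?i |` {a} = ?i" by (auto simp: restrict_map_def i fun_eq_iff)
      ultimately show ?thesis using that(1) by (auto simp: G_def)
    qed
  qed
  then show pg: "pseudogroup X G" using sub by (simp add: pseudogroup_def)
  have orb: "orbit_of G a = {a}" by (auto simp: orbit_of_def G_def i)
  have "\<forall>f\<in>G. dom f \<subseteq> {a} \<and> ran f \<subseteq> {a}"
    using di by (simp add: G_def)
  then have res: "restrict_pseudogroup G {a} = G"
    by (auto simp only: restrict_pseudogroup_def)
  have meets: "meets_every_orbit X G {a}" by (simp add: meets_every_orbit_def X_def orb)
  have subt: "subtopology X {a} = X" by (simp add: X_def)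
  have gen: "generates X {?i} G"
    unfolding generates_def
  proof (intro conjI allI impI)
    fix H assume H: "pseudogroup X H \<and> {?i} \<subseteq> H"
    then have "?i |` {} \<in> H"
      unfolding pseudogroup_def pseudo_star_group_def
      by (metis empty_subsetI insert_subset openin_empty)
    then show "G \<subseteq> H" using H by (simp add: G_def)
  qed (use pg in \<open>auto simp: G_def\<close>)
  have cl: "X closure_of {a} = {a}" and cpt: "compactin X {a}" and op: "openin X {a}"
    using closure_of_topspace[of X] by (simp_all add: X_def compactin_discrete_topology)
  show "compactly_generated X G"
    unfolding compactly_generated_def
  proof (rule exI[of _ "{a}"], rule exI[of _ "{?i}"], rule exI[of _ "{?i}"], intro conjI)
    show "\<exists>\<phi>. bij_betw \<phi> {?i} {?i} \<and>
        (\<forall>f\<in>{?i}. f \<subseteq>\<^sub>m \<phi> f \<and> X closure_of dom f \<subseteq> dom (\<phi> f))"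
      by (rule exI[of _ id]) (simp add: di cl)
    show "{?i} \<subseteq> restrict_pseudogroup G {a}" "{?i} \<subseteq> G"
      unfolding res by (simp_all add: G_def)
  qed (use gen meets op cpt cl in \<open>simp_all add: res subt invi symmetric_maps_def\<close>)
  show "topologically_transitive X G"
    unfolding topologically_transitive_def
  proof (intro allI impI)
    fix U V assume "openin X U \<and> U \<noteq> {} \<and> openin X V \<and> V \<noteq> {}"
    then have "U = {a}" "V = {a}" by (auto simp: X_def)
    moreover have "a \<in> ran (?i |` {a})" by (auto simp: ran_def restrict_map_def i)
    ultimately show "\<exists>g\<in>G. ran (g |` U) \<inter> V \<noteq> {}" by (auto simp: G_def)
  qed
  show "density_of_periodic_orbits X G"
    unfolding density_of_periodic_orbits_def
    by (rule exI[of _ "{a}"]) (use meets in \<open>simp add: res subt orb cl op\<close>)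
qed

end

theory Submission
  imports Defs
begin

text \<open>Suppose that sensitivity fails at scale \<open>c\<close>. Then some point \<open>x\<close> has a neighbourhood \<open>B\<close> which every
  element of \<open>S\<close> defined at \<open>x\<close> maps into the \<open>c\<close>-ball around the image of \<open>x\<close> (as far as the
  element is defined on \<open>B\<close>); call such a pair stable. Stability is carried along by elements of
  \<open>S\<close>, since \<open>S\<close> is closed under composition.

  Compact generation turns this local equicontinuity into a statement about orbits. The closures of
  the domains of the generators of \<open>G\<close> restricted to \<open>U\<close> are compact, so a Lebesgue number bounds from
  below the size of the balls on which the extended generators are defined and belong to \<open>S\<close>. If
  \<open>c\<close> is small compared with this number and a word in the generators is defined at one point of a
  stable \<open>B\<close>, then at each stage the image of \<open>B\<close> has diameter less than \<open>2c\<close>; hence the next extended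
  generator is defined on all of it, and the whole of \<open>B\<close> follows the itinerary of that point
  (\<open>stable_shadows\<close>). The set of points whose itinerary under the extended generators stays within
  \<open>2c\<close> of a given one is called its shadow. Points in the closure of a shadow still complete the
  itinerary, within the closed bound \<open>2c\<close> (\<open>closure_of_shadow\<close>).

  Choose a point \<open>q\<close> of \<open>U\<close> whose orbit is finite in \<open>U\<close> and a point \<open>x0\<close> of \<open>U\<close> outside this orbit;
  the latter exists because a finite open \<open>U\<close> meeting all orbits would force the space to be discrete.
  Both are chosen before \<open>c\<close>, so \<open>c\<close> may be assumed small compared with the distance from \<open>x0\<close> to
  the orbit of \<open>q\<close>. By transitivity a stable set may be moved close to \<open>x0\<close>; it contains a point \<open>p\<close>
  whose orbit is finite in \<open>U\<close>. For each of the finitely many points \<open>p'\<close> of that orbit in \<open>U\<close> fix one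
  itinerary from \<open>p'\<close> back to \<open>p\<close>. By transitivity again, points of the stable set can be moved
  arbitrarily close to \<open>q\<close>; the stable set is then carried along and \<open>p\<close> arrives at some \<open>p'\<close>, so
  that the arriving point lies in the shadow of the itinerary of \<open>p'\<close>. Thus \<open>q\<close> is in the closure of a
  finite union of shadows, hence in the closure of one of them, and follows an itinerary ending near
  \<open>p\<close>. So the orbit of \<open>q\<close> comes close to \<open>x0\<close>, a contradiction (\<open>not_stable\<close>).\<close>

section \<open>Partial homeomorphisms\<close>

definition map_image :: "('a \<rightharpoonup> 'b) \<Rightarrow> 'a set \<Rightarrow> 'b set" where
  "map_image f V = {y. \<exists>x\<in>V. f x = Some y}"

definition map_vimage :: "('a \<rightharpoonup> 'b) \<Rightarrow> 'b set \<Rightarrow> 'a set" where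
  "map_vimage f V = {x. \<exists>y\<in>V. f x = Some y}"

definition map_inj :: "('a \<rightharpoonup> 'b) \<Rightarrow> bool" where
  "map_inj f \<longleftrightarrow> (\<forall>x x' y. f x = Some y \<longrightarrow> f x' = Some y \<longrightarrow> x = x')"

text \<open>In this form the conditions on a map and on its inverse are interchanged by swapping images
  and preimages, and both are visibly preserved by composition; no subtopologies have to be
  handled.\<close>
lemma partial_homeos_iff:
  "f \<in> partial_homeos X \<longleftrightarrow>
     dom f \<subseteq> topspace X \<and> ran f \<subseteq> topspace X \<and> map_inj f \<and>
     (\<forall>V. openin X V \<longrightarrow> openin X (map_image f V) \<and> openin X (map_vimage f V))"
    (is "?L \<longleftrightarrow> ?R")
proof
  assume L: ?L
  then have od: "openin X (dom f)" and ore: "openin X (ran f)"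
    and h: "homeomorphic_map (subtopology X (dom f)) (subtopology X (ran f)) (\<lambda>x. the (f x))"
    by (auto simp: partial_homeos_def)
  have dsub: "dom f \<subseteq> topspace X" "ran f \<subseteq> topspace X"
    using od ore openin_subset by auto
  then have ts: "topspace (subtopology X (dom f)) = dom f"
    by (simp add: inf.absorb2)
  have inj: "inj_on (\<lambda>x. the (f x)) (dom f)"
    and cont: "continuous_map (subtopology X (dom f)) (subtopology X (ran f)) (\<lambda>x. the (f x))"
    and opn: "open_map (subtopology X (dom f)) (subtopology X (ran f)) (\<lambda>x. the (f x))"
    using h ts by (simp_all add: homeomorphic_eq_everything_map)
  have "map_inj f"
    unfolding map_inj_def
  proof (intro allI impI)
    fix x x' y assume "f x = Some y" "f x' = Some y"
    then show "x = x'" using inj_onD[OF inj, of x x'] by auto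
  qed
  moreover have "openin X (map_image f V)" if "openin X V" for V
  proof -
    have "openin (subtopology X (dom f)) (dom f \<inter> V)"
      using that by (auto simp: openin_subtopology)
    then have "openin (subtopology X (ran f)) ((\<lambda>x. the (f x)) ` (dom f \<inter> V))"
      using opn by (auto simp: open_map_def)
    then have "openin X ((\<lambda>x. the (f x)) ` (dom f \<inter> V))"
      using ore openin_trans_full by blast
    moreover have "(\<lambda>x. the (f x)) ` (dom f \<inter> V) = map_image f V"
      by (force simp: map_image_def image_iff)
    ultimately show ?thesis by simp
  qed
  moreover have "openin X (map_vimage f V)" if "openin X V" for V
  proof -
    have "openin (subtopology X (ran f)) (ran f \<inter> V)"
      using that by (auto simp: openin_subtopology)
    then have "openin (subtopology X (dom f)) {x \<in> dom f. the (f x) \<in> ran f \<inter> V}"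
      by (rule openin_continuous_map_preimage[OF cont, unfolded ts])
    then have "openin X {x \<in> dom f. the (f x) \<in> ran f \<inter> V}"
      using od openin_trans_full by blast
    moreover have "{x \<in> dom f. the (f x) \<in> ran f \<inter> V} = map_vimage f V"
      by (auto simp: map_vimage_def intro: ranI)
    ultimately show ?thesis by simp
  qed
  ultimately show ?R using dsub by simp
next
  assume R: ?R
  then have sub: "dom f \<subseteq> topspace X" "ran f \<subseteq> topspace X" and inj: "map_inj f"
    and imo: "\<And>V. openin X V \<Longrightarrow> openin X (map_image f V)"
    and vimo: "\<And>V. openin X V \<Longrightarrow> openin X (map_vimage f V)"
    by auto
  have "map_vimage f (topspace X) = dom f" "map_image f (topspace X) = ran f"
    using sub unfolding map_vimage_def map_image_def dom_def ran_def by blast+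
  then have od: "openin X (dom f)" and ore: "openin X (ran f)"
    using imo[OF openin_topspace] vimo[OF openin_topspace] by simp_all
  have ts: "topspace (subtopology X (dom f)) = dom f" "topspace (subtopology X (ran f)) = ran f"
    using sub by (simp_all add: inf.absorb2)
  have "homeomorphic_map (subtopology X (dom f)) (subtopology X (ran f)) (\<lambda>x. the (f x))"
  proof (rule bijective_open_imp_homeomorphic_map)
    show "(\<lambda>x. the (f x)) ` topspace (subtopology X (dom f)) = topspace (subtopology X (ran f))"
      unfolding ts by (force simp: ran_def image_iff)
    show "inj_on (\<lambda>x. the (f x)) (topspace (subtopology X (dom f)))"
      unfolding ts inj_on_def using inj
      by (auto simp: map_inj_def)
    show "continuous_map (subtopology X (dom f)) (subtopology X (ran f)) (\<lambda>x. the (f x))"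
      unfolding continuous_map_def ts
    proof (intro conjI allI impI)
      show "(\<lambda>x. the (f x)) \<in> dom f \<rightarrow> ran f" by (auto intro: ranI)
      fix W assume "openin (subtopology X (ran f)) W"
      then have "openin X W" using ore openin_trans_full by blast
      then have "openin X (map_vimage f W)" by (rule vimo)
      moreover have "{x \<in> dom f. the (f x) \<in> W} = map_vimage f W"
        by (auto simp: map_vimage_def)
      ultimately show "openin (subtopology X (dom f)) {x \<in> dom f. the (f x) \<in> W}"
        by (auto simp: openin_subtopology)
    qed
    show "open_map (subtopology X (dom f)) (subtopology X (ran f)) (\<lambda>x. the (f x))"
      unfolding open_map_def
    proof (intro allI impI)
      fix W assume W: "openin (subtopology X (dom f)) W"
      then have "openin X W" using od openin_trans_full by blast
      then have "openin X (map_image f W)" by (rule imo)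
      moreover have "(\<lambda>x. the (f x)) ` W = map_image f W"
        using openin_subset[OF W] by (force simp: map_image_def image_iff)
      ultimately show "openin (subtopology X (ran f)) ((\<lambda>x. the (f x)) ` W)"
        using \<open>(\<lambda>x. the (f x)) ` W = map_image f W\<close>
        by (auto simp: openin_subtopology map_image_def intro!: exI[of _ "map_image f W"] ranI)
    qed
  qed
  with od ore show ?L by (simp add: partial_homeos_def)
qed

lemma map_inverse_Some_iff:
  assumes "map_inj f"
  shows "map_inverse f y = Some x \<longleftrightarrow> f x = Some y"
proof -
  have "(THE x. f x = Some y) = x" if "f x = Some y" for x
    using assms that unfolding map_inj_def by blast
  then show ?thesis
    by (auto simp: map_inverse_def ran_def)
qed

lemma map_vimage_comp: "map_vimage (g \<circ>\<^sub>m f) V = map_vimage f (map_vimage g V)"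
  by (auto simp: map_vimage_def map_comp_Some_iff)

lemma map_image_comp: "map_image (g \<circ>\<^sub>m f) V = map_image g (map_image f V)"
  by (auto simp: map_image_def map_comp_Some_iff)

lemma partial_homeos_comp:
  assumes "f \<in> partial_homeos X" "g \<in> partial_homeos X"
  shows "g \<circ>\<^sub>m f \<in> partial_homeos X"
proof -
  have "dom (g \<circ>\<^sub>m f) \<subseteq> dom f" "ran (g \<circ>\<^sub>m f) \<subseteq> ran g"
    by (auto simp: ran_def map_comp_Some_iff)
  moreover have "map_inj (g \<circ>\<^sub>m f)"
    using assms unfolding partial_homeos_iff map_inj_def map_comp_Some_iff by metis
  ultimately show ?thesis
    using assms by (auto simp: partial_homeos_iff map_vimage_comp map_image_comp)
qed

lemma partial_homeos_inverse:
  assumes "f \<in> partial_homeos X"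
  shows "map_inverse f \<in> partial_homeos X"
proof -
  have i: "map_inj f" using assms by (simp add: partial_homeos_iff)
  note S = map_inverse_Some_iff[OF i]
  have "dom (map_inverse f) = ran f" "ran (map_inverse f) = dom f"
    by (auto simp: dom_def ran_def S)
  moreover have "map_inj (map_inverse f)" by (auto simp: map_inj_def S)
  moreover have "map_image (map_inverse f) V = map_vimage f V"
    "map_vimage (map_inverse f) V = map_image f V" for V
    by (auto simp: map_image_def map_vimage_def S)
  ultimately show ?thesis
    using assms by (auto simp: partial_homeos_iff)
qed

lemma partial_homeos_restrict:
  assumes "f \<in> partial_homeos X" "openin X V"
  shows "f |` V \<in> partial_homeos X"
proof -
  have "map_image (f |` V) W = map_image f (V \<inter> W)" 
    "map_vimage (f |` V) W = V \<inter> map_vimage f W" for W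
    by (auto simp: map_image_def map_vimage_def restrict_map_def)
  moreover have "dom (f |` V) \<subseteq> dom f"
    by auto
  moreover have "ran (f |` V) \<subseteq> ran f"
    by (auto simp: ran_def restrict_map_def)
  moreover have "map_inj (f |` V)"
    using assms by (auto simp: partial_homeos_iff map_inj_def restrict_map_def)
  ultimately show ?thesis
    using assms by (auto simp: partial_homeos_iff)
qed

lemma map_id_on_Some_iff: "map_id_on A x = Some y \<longleftrightarrow> x \<in> A \<and> y = x"
  by (auto simp: map_id_on_def restrict_map_def)

lemma partial_homeos_id: "map_id_on (topspace X) \<in> partial_homeos X"
proof -
  have "map_image (map_id_on (topspace X)) V = topspace X \<inter> V"
    "map_vimage (map_id_on (topspace X)) V = topspace X \<inter> V" for V
    by (auto simp: map_image_def map_vimage_def map_id_on_Some_iff)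
  then show ?thesis
    by (auto simp: partial_homeos_iff map_inj_def map_id_on_Some_iff dom_def ran_def)
qed

section \<open>Pseudogroups, generators and orbits\<close>

text \<open>Each pseudogroup axiom reduces, on pairs of a point and its image, to a property of an
  equivalence relation. Pseudogroups of this form are the ones through which orbits of a generated
  pseudogroup are compared with words in the generators.\<close>
lemma pseudogroup_inside_equiv:
  assumes refl: "\<And>x. x \<in> topspace X \<Longrightarrow> (x, x) \<in> R" and "sym R" "trans R"
  shows "pseudogroup X {f \<in> partial_homeos X. \<forall>x y. f x = Some y \<longrightarrow> (x, y) \<in> R}"
    (is "pseudogroup X ?H")
  unfolding pseudogroup_def pseudo_star_group_def
proof (intro conjI ballI allI impI)
  show "?H \<subseteq> partial_homeos X" by auto
  show "map_id_on (topspace X) \<in> ?H"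
    using refl by (auto simp: partial_homeos_id map_id_on_Some_iff)
  show "map_inverse f \<in> ?H" if "f \<in> ?H" for f
  proof -
    have "map_inj f" using that by (simp add: partial_homeos_iff)
    then show ?thesis
      using that \<open>sym R\<close> by (auto simp: partial_homeos_inverse map_inverse_Some_iff dest: symD)
  qed
  show "g \<circ>\<^sub>m f \<in> ?H" if "f \<in> ?H" "g \<in> ?H" for f g
  proof -
    have "(x, z) \<in> R" if "(g \<circ>\<^sub>m f) x = Some z" for x z
      using that \<open>f \<in> ?H\<close> \<open>g \<in> ?H\<close> transD[OF \<open>trans R\<close>, of x _ z]
      unfolding map_comp_Some_iff by blast
    with that show ?thesis by (simp add: partial_homeos_comp)
  qed
  show "f |` V \<in> ?H" if "f \<in> ?H" "openin X V \<and> V \<subseteq> dom f" for f V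
  proof -
    have "f |` V \<in> partial_homeos X" using that by (intro partial_homeos_restrict) auto
    moreover have "(x, y) \<in> R" if "(f |` V) x = Some y" for x y
      using that \<open>f \<in> ?H\<close> by (auto simp: restrict_map_def split: if_splits)
    ultimately show ?thesis by simp
  qed
  show "f \<in> ?H" if f: "f \<in> partial_homeos X"
    and loc: "\<forall>x\<in>dom f. \<exists>V. openin X V \<and> x \<in> V \<and> V \<subseteq> dom f \<and> f |` V \<in> ?H" for f
  proof -
    have "(x, y) \<in> R" if xy: "f x = Some y" for x y
    proof -
      obtain V where V: "x \<in> V" "f |` V \<in> ?H" using loc domI[where m = f, OF xy] by meson
      then have "(f |` V) x = Some y" using xy by simp
      with V(2) show ?thesis by simp
    qed
    with f show ?thesis by auto
  qed
qed

text \<open>The germs of \<open>S\<close> are closed under inversion and composition, because the restrictions that are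
  needed to match domains stay in \<open>S\<close>. This identifies the pseudogroup generated by \<open>S\<close>.\<close>
lemma pseudogroup_locally_in:
  assumes S: "pseudo_star_group X S"
  shows "pseudogroup X {f \<in> partial_homeos X.
           \<forall>x\<in>dom f. \<exists>V. openin X V \<and> x \<in> V \<and> V \<subseteq> dom f \<and> f |` V \<in> S}"
    (is "pseudogroup X ?H")
  unfolding pseudogroup_def pseudo_star_group_def
proof (intro conjI ballI allI impI)
  have idS: "map_id_on (topspace X) \<in> S" and invS: "\<And>f. f \<in> S \<Longrightarrow> map_inverse f \<in> S"
    and compS: "\<And>f g. f \<in> S \<Longrightarrow> g \<in> S \<Longrightarrow> g \<circ>\<^sub>m f \<in> S"
    and resS: "\<And>f V. f \<in> S \<Longrightarrow> openin X V \<Longrightarrow> V \<subseteq> dom f \<Longrightarrow> f |` V \<in> S"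
    using S by (auto simp: pseudo_star_group_def)
  show "?H \<subseteq> partial_homeos X" by auto
  have "map_id_on (topspace X) |` topspace X = map_id_on (topspace X)"
    "dom (map_id_on (topspace X)) = topspace X"
    by (auto simp: map_id_on_def)
  then show "map_id_on (topspace X) \<in> ?H"
    using idS by (auto simp: partial_homeos_id intro!: exI[of _ "topspace X"])
  show "map_inverse f \<in> ?H" if f: "f \<in> ?H" for f
  proof -
    have fp: "f \<in> partial_homeos X" using f by simp
    then have inj: "map_inj f" by (simp add: partial_homeos_iff)
    note Sm = map_inverse_Some_iff[OF inj]
    have "\<exists>V. openin X V \<and> y \<in> V \<and> V \<subseteq> dom (map_inverse f) \<and> map_inverse f |` V \<in> S"
      if "y \<in> dom (map_inverse f)" for y
    proof -
      obtain x where x: "f x = Some y" using \<open>y \<in> dom (map_inverse f)\<close> Sm by auto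
      then obtain V where V: "openin X V" "x \<in> V" "V \<subseteq> dom f" "f |` V \<in> S"
        using f by auto
      have injV: "map_inj (f |` V)"
        using inj by (auto simp: map_inj_def restrict_map_def)
      have "map_inverse (f |` V) = map_inverse f |` map_image f V"
      proof
        fix z
        have "map_inverse (f |` V) z = Some w \<longleftrightarrow> (map_inverse f |` map_image f V) z = Some w" for w
          using inj unfolding map_inverse_Some_iff[OF injV] 
          by (auto simp: restrict_map_def Sm map_image_def map_inj_def)
        then show "map_inverse (f |` V) z = (map_inverse f |` map_image f V) z"
          by (metis option.exhaust)
      qed
      moreover have "map_image f V \<subseteq> dom (map_inverse f)"
        using V by (auto simp: map_image_def Sm dom_def)
      moreover have "openin X (map_image f V)" "y \<in> map_image f V"
        using fp V x by (auto simp: partial_homeos_iff map_image_def)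
      ultimately show ?thesis using invS[OF V(4)] by metis
    qed
    with fp show ?thesis by (simp add: partial_homeos_inverse)
  qed
  show "g \<circ>\<^sub>m f \<in> ?H" if f: "f \<in> ?H" and g: "g \<in> ?H" for f g
  proof -
    have "\<exists>V. openin X V \<and> x \<in> V \<and> V \<subseteq> dom (g \<circ>\<^sub>m f) \<and> (g \<circ>\<^sub>m f) |` V \<in> S"
      if x: "x \<in> dom (g \<circ>\<^sub>m f)" for x
    proof -
      obtain y z where "f x = Some y" "g y = Some z"
        using x unfolding dom_def map_comp_Some_iff mem_Collect_eq not_None_eq by blast
      then have y: "f x = Some y" "y \<in> dom g" by auto
      obtain V where V: "openin X V" "x \<in> V" "V \<subseteq> dom f" "f |` V \<in> S"
        using f y by auto
      obtain W where W: "openin X W" "y \<in> W" "W \<subseteq> dom g" "g |` W \<in> S"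
        using g y by auto
      have "(g \<circ>\<^sub>m f) |` (V \<inter> map_vimage f W) = (g |` W) \<circ>\<^sub>m (f |` V)"
        by (auto simp: fun_eq_iff map_comp_def restrict_map_def map_vimage_def split: option.splits)
      moreover have "V \<inter> map_vimage f W \<subseteq> dom (g \<circ>\<^sub>m f)"
        using W(3) by (force simp: map_vimage_def map_comp_Some_iff)
      moreover have "openin X (V \<inter> map_vimage f W)"
        using f V W by (auto simp: partial_homeos_iff)
      moreover have "x \<in> V \<inter> map_vimage f W"
        using V W y by (auto simp: map_vimage_def)
      ultimately show ?thesis using compS[OF V(4) W(4)] by metis
    qed
    with f g show ?thesis by (simp add: partial_homeos_comp)
  qed
  show "f |` V \<in> ?H" if f: "f \<in> ?H" and V: "openin X V \<and> V \<subseteq> dom f" for f V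
  proof -
    have "\<exists>W. openin X W \<and> x \<in> W \<and> W \<subseteq> dom (f |` V) \<and> (f |` V) |` W \<in> S"
      if x: "x \<in> dom (f |` V)" for x
    proof -
      obtain W where W: "openin X W" "x \<in> W" "W \<subseteq> dom f" "f |` W \<in> S"
        using f x by auto
      have "(f |` V) |` (V \<inter> W) = (f |` W) |` (V \<inter> W)" by (simp add: Int_ac)
      moreover have "(f |` W) |` (V \<inter> W) \<in> S"
        by (rule resS) (use V W in auto)
      ultimately show ?thesis using V W x by (intro exI[of _ "V \<inter> W"]) auto
    qed
    with f V show ?thesis by (simp add: partial_homeos_restrict)
  qed
  show "f \<in> ?H" if f: "f \<in> partial_homeos X"
    and loc: "\<forall>x\<in>dom f. \<exists>V. openin X V \<and> x \<in> V \<and> V \<subseteq> dom f \<and> f |` V \<in> ?H" for f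
  proof -
    have "\<exists>W. openin X W \<and> x \<in> W \<and> W \<subseteq> dom f \<and> f |` W \<in> S" if x: "x \<in> dom f" for x
    proof -
      from bspec[OF loc x]
      obtain V where V: "openin X V \<and> x \<in> V \<and> V \<subseteq> dom f \<and> f |` V \<in> ?H" by (rule exE)
      then have "\<forall>x\<in>dom (f |` V). \<exists>W. openin X W \<and> x \<in> W \<and> W \<subseteq> dom (f |` V) \<and> (f |` V) |` W \<in> S"
        by simp
      moreover have "x \<in> dom (f |` V)" using V x by simp
      ultimately obtain W
        where W: "openin X W" "x \<in> W" "W \<subseteq> dom (f |` V)" "(f |` V) |` W \<in> S"
        by meson
      then have "V \<inter> W = W" by auto
      then show ?thesis using W by auto
    qed
    with f show ?thesis by simp
  qed
qed

lemma generates_locally_in: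
  assumes "pseudo_star_group X S" "generates X S G" "g \<in> G" "x \<in> dom g"
  obtains V where "openin X V" "x \<in> V" "V \<subseteq> dom g" "g |` V \<in> S"
proof -
  let ?H = "{f \<in> partial_homeos X.
           \<forall>x\<in>dom f. \<exists>V. openin X V \<and> x \<in> V \<and> V \<subseteq> dom f \<and> f |` V \<in> S}"
  have "S \<subseteq> ?H"
  proof
    fix f assume f: "f \<in> S"
    then have fp: "f \<in> partial_homeos X" using assms(1) by (auto simp: pseudo_star_group_def)
    then have o: "openin X (dom f)" by (simp add: partial_homeos_def)
    have "f |` dom f = f"
      by (rule ext) (simp add: restrict_map_def domIff)
    with o f have "\<exists>V. openin X V \<and> x \<in> V \<and> V \<subseteq> dom f \<and> f |` V \<in> S" if "x \<in> dom f" for x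
      using that by (intro exI[of _ "dom f"]) simp
    with fp show "f \<in> ?H" by simp
  qed
  then have "G \<subseteq> ?H"
    using assms(2) pseudogroup_locally_in[OF assms(1)] unfolding generates_def by blast
  with assms(3) have "\<forall>x\<in>dom g. \<exists>V. openin X V \<and> x \<in> V \<and> V \<subseteq> dom g \<and> g |` V \<in> S"
    by auto
  then show ?thesis using assms(4) that by meson
qed

text \<open>The reachability relation of a symmetric \<open>F\<close> is an equivalence, so the partial homeomorphisms
  inside it form a pseudogroup containing \<open>F\<close>, and hence containing \<open>G\<close>.\<close>
lemma generates_reachable:
  assumes F: "generates X F G" "symmetric_maps F" and g: "g \<in> G" "g x = Some y"
  shows "(x, y) \<in> {(a, b). \<exists>f\<in>F. f a = Some b}\<^sup>*" (is "_ \<in> ?R\<^sup>*")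
proof -
  have FG: "F \<subseteq> G" "G \<subseteq> partial_homeos X"
    using F by (auto simp: generates_def pseudogroup_def pseudo_star_group_def)
  have "sym ?R"
  proof (rule symI)
    fix a b assume "(a, b) \<in> ?R"
    then obtain f where f: "f \<in> F" "f a = Some b" by auto
    then have "map_inverse f b = Some a"
      using FG by (subst map_inverse_Some_iff) (auto simp: partial_homeos_iff)
    then show "(b, a) \<in> ?R" using F(2) f by (auto simp: symmetric_maps_def)
  qed
  then have "pseudogroup X {f \<in> partial_homeos X. \<forall>x y. f x = Some y \<longrightarrow> (x, y) \<in> ?R\<^sup>*}"
    by (intro pseudogroup_inside_equiv) (auto intro: sym_rtrancl trans_rtrancl)
  moreover have "F \<subseteq> {f \<in> partial_homeos X. \<forall>x y. f x = Some y \<longrightarrow> (x, y) \<in> ?R\<^sup>*}"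
    using FG by blast
  ultimately show ?thesis using F(1) g unfolding generates_def by blast
qed

lemma pseudo_star_groupD:
  assumes "pseudo_star_group X G"
  shows "f \<in> G \<Longrightarrow> f \<in> partial_homeos X"
    and "map_id_on (topspace X) \<in> G"
    and "f \<in> G \<Longrightarrow> map_inverse f \<in> G"
    and "f \<in> G \<Longrightarrow> g \<in> G \<Longrightarrow> g \<circ>\<^sub>m f \<in> G"
    and "f \<in> G \<Longrightarrow> openin X V \<Longrightarrow> V \<subseteq> dom f \<Longrightarrow> f |` V \<in> G"
  using assms by (auto simp: pseudo_star_group_def)

lemma partial_homeosD:
  assumes "f \<in> partial_homeos X"
  shows "f x = Some y \<Longrightarrow> x \<in> topspace X" "f x = Some y \<Longrightarrow> y \<in> topspace X"
    and "map_inj f"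
    and "openin X V \<Longrightarrow> openin X (map_image f V)"
    and "openin X V \<Longrightarrow> openin X (map_vimage f V)"
  using assms by (auto simp: partial_homeos_iff intro: ranI)

lemma orbit_ofI: "g \<in> G \<Longrightarrow> g x = Some y \<Longrightarrow> y \<in> orbit_of G x"
  by (auto simp: orbit_of_def)

lemma orbit_of_refl:
  assumes "pseudo_star_group X G" "x \<in> topspace X"
  shows "x \<in> orbit_of G x"
  by (rule orbit_ofI[OF pseudo_star_groupD(2)[OF assms(1)]])
    (simp add: map_id_on_Some_iff assms(2))

lemma orbit_of_sym:
  assumes "pseudo_star_group X G" "y \<in> orbit_of G x"
  shows "x \<in> orbit_of G y"
proof -
  obtain g where g: "g \<in> G" "g x = Some y" using assms(2) by (auto simp: orbit_of_def)
  note inj = partial_homeosD(3)[OF pseudo_star_groupD(1)[OF assms(1) g(1)]]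
  show ?thesis
    by (rule orbit_ofI[OF pseudo_star_groupD(3)[OF assms(1) g(1)]])
      (simp add: map_inverse_Some_iff[OF inj] g(2))
qed

lemma orbit_of_trans:
  assumes "pseudo_star_group X G" "y \<in> orbit_of G x" "z \<in> orbit_of G y"
  shows "z \<in> orbit_of G x"
proof -
  obtain f g where "f \<in> G" "f x = Some y" "g \<in> G" "g y = Some z"
    using assms(2,3) by (auto simp: orbit_of_def)
  then have "g \<circ>\<^sub>m f \<in> G" "(g \<circ>\<^sub>m f) x = Some z"
    using pseudo_star_groupD(4)[OF assms(1)] by (auto simp: map_comp_Some_iff)
  then show ?thesis by (auto simp: orbit_of_def)
qed

text \<open>An element of \<open>G\<close> joining two points of \<open>U\<close> can be cut down to a neighbourhood that stays in
  \<open>U\<close> together with its image.\<close>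
lemma orbit_of_restrict_pseudogroup:
  assumes G: "pseudo_star_group X G" and U: "openin X U" and x: "x \<in> U"
  shows "orbit_of (restrict_pseudogroup G U) x = orbit_of G x \<inter> U"
proof
  show "orbit_of (restrict_pseudogroup G U) x \<subseteq> orbit_of G x \<inter> U"
    by (auto simp: orbit_of_def restrict_pseudogroup_def intro: ranI)
next
  show "orbit_of G x \<inter> U \<subseteq> orbit_of (restrict_pseudogroup G U) x"
  proof
    fix y assume "y \<in> orbit_of G x \<inter> U"
    then obtain g where g: "g \<in> G" "g x = Some y" and y: "y \<in> U"
      by (auto simp: orbit_of_def)
    let ?V = "U \<inter> map_vimage g U"
    have "openin X ?V"
      using partial_homeosD(5)[OF pseudo_star_groupD(1)[OF G g(1)] U] U by blast
    moreover have "?V \<subseteq> dom g" by (auto simp: map_vimage_def)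
    ultimately have "g |` ?V \<in> G" by (rule pseudo_star_groupD(5)[OF G g(1)])
    moreover have "dom (g |` ?V) \<subseteq> U" by auto
    moreover have "ran (g |` ?V) \<subseteq> U"
      by (auto simp: ran_def restrict_map_def map_vimage_def split: if_splits)
    moreover have "(g |` ?V) x = Some y"
      using x y g(2) by (auto simp: restrict_map_def map_vimage_def)
    ultimately show "y \<in> orbit_of (restrict_pseudogroup G U) x"
      by (intro orbit_ofI[of "g |` ?V"]) (auto simp only: restrict_pseudogroup_def mem_Collect_eq)
  qed
qed

section \<open>Stable sets and shadows of itineraries\<close>

text \<open>The constant \<open>3 * c\<close> in \<open>ext_near\<close> leaves room for two estimates: images of stable
  sets have diameter less than \<open>2 * c\<close>, and limits of points at distance less than \<open>2 * c\<close> must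
  still lie strictly inside the ball on which the extended generator is available.\<close>
locale shadowing = Metric_space M d for M :: "'a set" and d +
  fixes G S F :: "('a \<rightharpoonup> 'a) set" and ext :: "('a \<rightharpoonup> 'a) \<Rightarrow> ('a \<rightharpoonup> 'a)"
    and U :: "'a set" and c :: real
  assumes G: "pseudo_star_group mtopology G"
    and S: "pseudo_star_group mtopology S"
    and SG: "generates mtopology S G"
    and U: "openin mtopology U"
    and F: "generates (subtopology mtopology U) F (restrict_pseudogroup G U)"
    and symF: "symmetric_maps F"
    and c: "0 < c"
    and ext_in_G: "f \<in> F \<Longrightarrow> ext f \<in> G"
    and ext_extends: "f \<in> F \<Longrightarrow> f \<subseteq>\<^sub>m ext f"
    and ext_near: "f \<in> F \<Longrightarrow> a \<in> dom f \<Longrightarrow>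
      \<exists>V. openin mtopology V \<and> mball a (3 * c) \<subseteq> V \<and> V \<subseteq> dom (ext f) \<and> ext f |` V \<in> S"
begin

text \<open>Equicontinuity of \<open>S\<close> at \<open>x\<close> with the single constant \<open>c\<close>. The elements \<open>t\<close> are only required
  to be defined at \<open>x\<close> and at the point compared with it, since \<open>S\<close> contains maps with
  arbitrarily small domains.\<close>
definition stable :: "'a \<Rightarrow> 'a set \<Rightarrow> bool" where
  "stable x B \<longleftrightarrow> openin mtopology B \<and> x \<in> B \<and>
     (\<forall>t\<in>S. \<forall>u v. \<forall>z\<in>B. t x = Some u \<longrightarrow> t z = Some v \<longrightarrow> d u v < c)"

lemma stableD:
  assumes "stable x B"
  shows "openin mtopology B" "x \<in> B" "B \<subseteq> M"
    and "t \<in> S \<Longrightarrow> t x = Some u \<Longrightarrow> z \<in> B \<Longrightarrow> t z = Some v \<Longrightarrow> d u v < c"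
proof -
  show "openin mtopology B" "x \<in> B" using assms by (simp_all add: stable_def)
  then show "B \<subseteq> M" using openin_subset[of mtopology B] by simp
  show "d u v < c" if "t \<in> S" "t x = Some u" "z \<in> B" "t z = Some v"
    using assms that unfolding stable_def by blast
qed

lemma stable_subset:
  assumes "stable x B" "openin mtopology C" "C \<subseteq> B" "x \<in> C"
  shows "stable x C"
  using assms unfolding stable_def by blast

text \<open>Stability applied to the identity bounds the distance to \<open>x\<close> by \<open>c\<close>.\<close>
lemma stable_diameter:
  assumes B: "stable x B" and yz: "y \<in> B" "z \<in> B"
  shows "d y z < 2 * c"
proof -
  have "d x w < c" if "w \<in> B" for w
    using stableD(2,3)[OF B] that
    by (intro stableD(4)[OF B pseudo_star_groupD(2)[OF S], of x w w]) (auto simp: map_id_on_Some_iff)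
  from this[OF yz(1)] this[OF yz(2)] show ?thesis
    using triangle[of y x z] commute[of x y] stableD(2,3)[OF B] yz by fastforce
qed

lemma stable_image:
  assumes B: "stable x B" and t: "t \<in> S" "t x = Some u"
  shows "stable u (map_image t B)"
  unfolding stable_def
proof (intro conjI ballI allI impI)
  show "openin mtopology (map_image t B)"
    by (rule partial_homeosD(4)[OF pseudo_star_groupD(1)[OF S t(1)] stableD(1)[OF B]])
  show "u \<in> map_image t B" using t stableD(2)[OF B] by (auto simp: map_image_def)
  fix s a b z assume s: "s \<in> S" "z \<in> map_image t B" "s u = Some a" "s z = Some b"
  then obtain w where w: "w \<in> B" "t w = Some z" by (auto simp: map_image_def)
  show "d a b < c"
  proof (rule stableD(4)[OF B])
    show "s \<circ>\<^sub>m t \<in> S" by (rule pseudo_star_groupD(4)[OF S t(1) s(1)])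
  qed (use s t w in \<open>auto simp: map_comp_Some_iff\<close>)
qed

text \<open>Here \<open>shadows a b A\<close> means that some itinerary \<open>a = a\<^sub>0, ..., a\<^sub>n = b\<close> of generators leads from \<open>a\<close> to
  \<open>b\<close>, and that \<open>A\<close> consists of the points whose images under the corresponding extended
  generators are defined and within \<open>2 * c\<close> of \<open>a\<^sub>i\<close> at each stage. Recording \<open>A\<close> instead of the word
  makes the finite choice of one itinerary per point a choice of sets.\<close>
inductive shadows :: "'a \<Rightarrow> 'a \<Rightarrow> 'a set \<Rightarrow> bool" where
  base: "a \<in> M \<Longrightarrow> shadows a a (mball a (2 * c))"
| step: "f \<in> F \<Longrightarrow> f a = Some a' \<Longrightarrow> shadows a' b A \<Longrightarrow>
     shadows a b {z \<in> mball a (2 * c). \<exists>z'\<in>A. ext f z = Some z'}"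

lemma ext_Some: "f \<in> F \<Longrightarrow> f a = Some b \<Longrightarrow> ext f a = Some b"
  using ext_extends by (force simp: map_le_def)

text \<open>Between two points of \<open>U\<close> on the same orbit there is an itinerary that never leaves \<open>U\<close>,
  because \<open>F\<close> generates the restriction of \<open>G\<close> to \<open>U\<close>.\<close>
lemma shadows_exists:
  assumes "x \<in> U" "y \<in> U" "y \<in> orbit_of G x"
  shows "\<exists>A. shadows x y A"
proof -
  have "y \<in> orbit_of (restrict_pseudogroup G U) x"
    using orbit_of_restrict_pseudogroup[OF G U] assms by blast
  then obtain g where "g \<in> restrict_pseudogroup G U" "g x = Some y"
    by (auto simp: orbit_of_def)
  then have "(x, y) \<in> {(a, b). \<exists>f\<in>F. f a = Some b}\<^sup>*"
    by (rule generates_reachable[OF F symF])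
  then show ?thesis
  proof (induction rule: converse_rtrancl_induct)
    case base
    then show ?case using assms(2) openin_subset[OF U] shadows.base by auto
  next
    case (step x z)
    then show ?case using shadows.step by fastforce
  qed
qed

text \<open>A stable set follows the itinerary of any of its points: its diameter is less than \<open>2 * c\<close>, so the
  first extended generator is defined on all of it and restricts there to an element of \<open>S\<close>; the image is
  again stable, now around the image of \<open>x\<close>.\<close>
lemma stable_shadows:
  assumes "shadows a b A" "stable x B" "a \<in> B"
  shows "B \<subseteq> A \<and> (\<exists>s\<in>S. B \<subseteq> dom s \<and> s a = Some b)"
  using assms
proof (induction arbitrary: x B rule: shadows.induct)
  case (base a)
  have "B \<subseteq> mball a (2 * c)"
    using stable_diameter[OF base.prems] stableD(3)[OF base.prems(1)] base.hyps by auto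
  moreover have "B \<subseteq> dom (map_id_on M)" "map_id_on M a = Some a"
    using stableD(3)[OF base.prems(1)] base.hyps by (auto simp: map_id_on_def)
  moreover have "map_id_on M \<in> S" using pseudo_star_groupD(2)[OF S] by simp
  ultimately show ?case by blast
next
  case (step f a a' b A)
  have near: "B \<subseteq> mball a (2 * c)"
    using stable_diameter[OF step.prems] stableD(3)[OF step.prems(1)] step.prems by auto
  obtain V where V: "mball a (3 * c) \<subseteq> V" "V \<subseteq> dom (ext f)" "ext f |` V \<in> S"
    using ext_near[OF step.hyps(1), of a] step.hyps(2) by blast
  let ?t = "ext f |` V"
  have BV: "B \<subseteq> V" using near V(1) c by (force simp: subset_iff)
  then have Bt: "B \<subseteq> dom ?t" using V(2) by auto
  have "x \<in> dom ?t" using stableD(2)[OF step.prems(1)] Bt by blast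
  then obtain u where u: "?t x = Some u" by blast
  let ?C = "map_image ?t B"
  have C: "stable u ?C" by (rule stable_image[OF step.prems(1) V(3) u])
  have ta: "?t a = Some a'"
    using ext_Some[OF step.hyps(1,2)] BV step.prems(2) by auto
  then have "a' \<in> ?C" using step.prems(2) by (auto simp: map_image_def)
  from step.IH[OF C this] obtain s where CA: "?C \<subseteq> A"
    and s: "s \<in> S" "?C \<subseteq> dom s" "s a' = Some b" by blast
  have "\<exists>z'\<in>A. ext f z = Some z'" if z: "z \<in> B" for z
  proof -
    obtain z' where z': "?t z = Some z'" using Bt z by blast
    then have "z' \<in> A" using CA z by (auto simp: map_image_def)
    moreover have "ext f z = Some z'" using z' BV z by auto
    ultimately show ?thesis by blast
  qed
  then have "B \<subseteq> {z \<in> mball a (2 * c). \<exists>z'\<in>A. ext f z = Some z'}"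
    using near by blast
  moreover have "s \<circ>\<^sub>m ?t \<in> S" by (rule pseudo_star_groupD(4)[OF S V(3) s(1)])
  moreover have "B \<subseteq> dom (s \<circ>\<^sub>m ?t)"
  proof
    fix z assume z: "z \<in> B"
    then obtain z' where z': "?t z = Some z'" using Bt by blast
    then have "z' \<in> ?C" using z by (auto simp: map_image_def)
    then have "z' \<in> dom s" using s(2) by blast
    then show "z \<in> dom (s \<circ>\<^sub>m ?t)" using z' by (simp add: map_comp_def domIff)
  qed
  moreover have "(s \<circ>\<^sub>m ?t) a = Some b" using ta s(3) by (simp add: map_comp_Some_iff)
  ultimately show ?case by blast
qed

text \<open>A limit of points of \<open>A\<close> is within \<open>2 * c\<close> of \<open>a\<close> and therefore in the open domain of the first extended
  generator. By continuity, its image is a limit of points of the remaining shadow.\<close>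
lemma closure_of_shadow:
  assumes "shadows a b A" "q \<in> mtopology closure_of A"
  shows "\<exists>q'\<in>orbit_of G q. d q' b \<le> 2 * c"
  using assms
proof (induction arbitrary: q rule: shadows.induct)
  case (base a)
  have "mtopology closure_of mball a (2 * c) \<subseteq> mcball a (2 * c)"
    by (simp add: closure_of_minimal mball_subset_mcball)
  then have "q \<in> mcball a (2 * c)" using base.prems by blast
  then have "q \<in> orbit_of G q" "d q a \<le> 2 * c"
    using orbit_of_refl[OF G, of q] commute[of q a] by auto
  then show ?case by blast
next
  case (step f a a' b A)
  let ?D = "{z \<in> mball a (2 * c). \<exists>z'\<in>A. ext f z = Some z'}"
  have "mtopology closure_of ?D \<subseteq> mcball a (2 * c)"
    by (rule closure_of_minimal) (use mball_subset_mcball[of a "2 * c"] in auto)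
  then have "q \<in> mcball a (2 * c)" using step.prems by blast
  then have "q \<in> mball a (3 * c)" using c by auto
  moreover obtain V where "mball a (3 * c) \<subseteq> V" "V \<subseteq> dom (ext f)"
    using ext_near[OF step.hyps(1), of a] step.hyps(2) by blast
  ultimately have "q \<in> dom (ext f)" by blast
  then obtain q1 where q1: "ext f q = Some q1" by blast
  note extG = ext_in_G[OF step.hyps(1)]
  note ph = pseudo_star_groupD(1)[OF G extG]
  have "q1 \<in> mtopology closure_of A"
    unfolding in_closure_of
  proof (intro conjI allI impI)
    show "q1 \<in> topspace mtopology" by (rule partial_homeosD(2)[OF ph q1])
    fix T assume T: "q1 \<in> T \<and> openin mtopology T"
    then have "openin mtopology (map_vimage (ext f) T)" "q \<in> map_vimage (ext f) T"
      using partial_homeosD(5)[OF ph] q1 by (auto simp: map_vimage_def)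
    then obtain z where "z \<in> ?D" "z \<in> map_vimage (ext f) T"
      using step.prems unfolding in_closure_of by meson
    then show "\<exists>y. y \<in> A \<and> y \<in> T" by (auto simp: map_vimage_def)
  qed
  from step.IH[OF this] obtain q' where "q' \<in> orbit_of G q1" "d q' b \<le> 2 * c" by blast
  moreover have "q1 \<in> orbit_of G q" using extG q1 by (auto simp: orbit_of_def)
  ultimately show ?case using orbit_of_trans[OF G] by blast
qed

lemma S_subset_G: "S \<subseteq> G"
  using SG by (simp add: generates_def)

text \<open>The element of \<open>S\<close> taking \<open>y\<close> to \<open>z\<close> can be chosen with a domain that contains all of \<open>B\<close>, in
  particular the centre \<open>x\<close>; without this, stability would not pass to the image.\<close>
lemma stable_transport:
  assumes B: "stable x B" "y \<in> B" "B \<subseteq> U" and z: "z \<in> U" "z \<in> orbit_of G y"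
  obtains s x' where "s \<in> S" "B \<subseteq> dom s"
    "stable x' (map_image s B)" "z \<in> map_image s B"
proof -
  obtain A where "shadows y z A" using shadows_exists[of y z] B z by blast
  from stable_shadows[OF this B(1,2)]
  obtain s where s: "s \<in> S" "B \<subseteq> dom s" "s y = Some z" by blast
  have "x \<in> dom s" using stableD(2)[OF B(1)] s(2) by blast
  then obtain x' where x': "s x = Some x'" by blast
  show thesis
    by (rule that[OF s(1,2) stable_image[OF B(1) s(1) x']]) (use s B in \<open>auto simp: map_image_def\<close>)
qed

lemma transitive_meets:
  assumes "topologically_transitive mtopology G"
    "openin mtopology V" "V \<noteq> {}" "openin mtopology W" "W \<noteq> {}"
  obtains y z where "y \<in> V" "z \<in> W" "z \<in> orbit_of G y"
proof -
  obtain g where g: "g \<in> G" "ran (g |` V) \<inter> W \<noteq> {}"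
    using assms unfolding topologically_transitive_def by blast
  then obtain y z where yz: "(g |` V) y = Some z" "z \<in> W" by (auto simp: ran_def)
  then have "y \<in> V" "g y = Some z" by (auto simp: restrict_map_def split: if_splits)
  then show thesis using that[of y z] yz g(1) by (auto simp: orbit_of_def)
qed

text \<open>A stable set would force the orbit of \<open>q\<close> to come near \<open>x0\<close>: move the stable set near \<open>x0\<close>, choose
  in it a point \<open>p\<close> with finite orbit in \<open>U\<close>, and let \<open>q\<close> shadow an itinerary ending at \<open>p\<close>.\<close>
lemma not_stable:
  assumes trans: "topologically_transitive mtopology G"
    and meets: "meets_every_orbit mtopology G U"
    and periodic: "\<And>V. openin mtopology V \<Longrightarrow> V \<noteq> {} \<Longrightarrow> \<exists>p\<in>V. finite (orbit_of G p \<inter> U)"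
    and q: "q \<in> M" "mball q (3 * c) \<subseteq> U"
    and x0: "x0 \<in> M" "mball x0 (5 * c) \<subseteq> U - orbit_of G q"
  shows "\<not> stable x B"
proof
  assume B: "stable x B"
  \<comment> \<open>Words in the generators start in \<open>U\<close>, so the centre itself has to be moved there first.\<close>
  obtain B1 x1 where B1: "stable x1 B1" "B1 \<subseteq> U"
  proof -
    obtain g x1 where g: "g \<in> G" "g x = Some x1" "x1 \<in> U"
      using meets stableD(2,3)[OF B] by (fastforce simp: meets_every_orbit_def orbit_of_def)
    then have "x \<in> dom g" by blast
    then obtain V where V: "openin mtopology V" "x \<in> V" "V \<subseteq> dom g" "g |` V \<in> S"
      using generates_locally_in[OF S SG g(1)] by metis
    then have "(g |` V) x = Some x1" using g by simp
    then have st: "stable x1 (map_image (g |` V) B)" by (rule stable_image[OF B V(4)])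
    have "stable x1 (map_image (g |` V) B \<inter> U)"
      by (rule stable_subset[OF st]) (use stableD[OF st] U g in auto)
    then show ?thesis using that by blast
  qed
  have ball0: "openin mtopology (mball x0 c)" "mball x0 c \<noteq> {}"
    using x0 c by (auto simp: mball_eq_empty)
  have near: "mball a r \<subseteq> mball a r'" if "r \<le> r'" for a r r' using that by auto
  obtain B2 x2 where B2: "stable x2 B2" "B2 \<subseteq> mball x0 (3 * c)"
  proof -
    obtain y z where yz: "y \<in> B1" "z \<in> mball x0 c" "z \<in> orbit_of G y"
      using transitive_meets[OF trans stableD(1)[OF B1(1)] _ ball0] stableD(2)[OF B1(1)] by blast
    have "z \<in> U" using yz(2) x0(2) near[of c "5 * c" x0] c by auto
    from stable_transport[OF B1(1) yz(1) B1(2) this yz(3)]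
    obtain s x' where s: "stable x' (map_image s B1)" "z \<in> map_image s B1" .
    have "map_image s B1 \<subseteq> mball x0 (3 * c)"
    proof
      fix w assume w: "w \<in> map_image s B1"
      then have "d z w < 2 * c" by (rule stable_diameter[OF s])
      moreover have "w \<in> M" using stableD(3)[OF s(1)] w by blast
      ultimately show "w \<in> mball x0 (3 * c)" using yz(2) triangle[of x0 z w] by auto
    qed
    then show ?thesis using that s(1) by blast
  qed
  have B2U: "B2 \<subseteq> U" using B2(2) x0(2) near[of "3 * c" "5 * c" x0] c by auto
  obtain p where p: "p \<in> B2" "finite (orbit_of G p \<inter> U)"
    using periodic[OF stableD(1)[OF B2(1)]] stableD(2)[OF B2(1)] by blast
  have pU: "p \<in> U" using p B2U by blast
  let ?P = "orbit_of G p \<inter> U"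
  have "\<forall>p'\<in>?P. \<exists>A. shadows p' p A"
    using shadows_exists[OF _ pU] orbit_of_sym[OF G] by blast
  then obtain A where A: "\<And>p'. p' \<in> ?P \<Longrightarrow> shadows p' p (A p')" by metis
  \<comment> \<open>The itineraries are fixed before \<open>q\<close> is approached; as there are finitely many,
    a single one serves in the limit.\<close>
  have "q \<in> mtopology closure_of (\<Union>p'\<in>?P. A p')"
    unfolding in_closure_of
  proof (intro conjI allI impI)
    show "q \<in> topspace mtopology" using q by simp
    fix T assume T: "q \<in> T \<and> openin mtopology T"
    let ?W = "T \<inter> mball q c"
    have W: "openin mtopology ?W" "?W \<noteq> {}" using T q c by auto
    obtain y z where yz: "y \<in> B2" "z \<in> ?W" "z \<in> orbit_of G y"
      using transitive_meets[OF trans stableD(1)[OF B2(1)] _ W] p(1) by blast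
    \<comment> \<open>The point \<open>y\<close> is moved to \<open>z\<close> near \<open>q\<close>, and the map doing this takes \<open>p\<close> to some \<open>p'\<close> near \<open>z\<close>.\<close>
    have "z \<in> U" using yz(2) q(2) near[of c "3 * c" q] c by auto
    from stable_transport[OF B2(1) yz(1) B2U this yz(3)]
    obtain s x' where s: "s \<in> S" "B2 \<subseteq> dom s"
      and st: "stable x' (map_image s B2)" "z \<in> map_image s B2" .
    obtain p' where p': "s p = Some p'" using s(2) p(1) by blast
    then have p'im: "p' \<in> map_image s B2" using p(1) by (auto simp: map_image_def)
    then have "d z p' < 2 * c" "p' \<in> M"
      using stable_diameter[OF st] stableD(3)[OF st(1)] by auto
    then have "p' \<in> mball q (3 * c)" using yz(2) triangle[of q z p'] by auto
    then have "p' \<in> ?P" using q(2) p' s(1) S_subset_G by (auto simp: orbit_of_def)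
    moreover have "z \<in> A p'" using stable_shadows[OF A[OF \<open>p' \<in> ?P\<close>] st(1) p'im] st(2) by blast
    ultimately show "\<exists>y. y \<in> (\<Union>p'\<in>?P. A p') \<and> y \<in> T" using yz(2) by blast
  qed
  then have "q \<in> (\<Union>p'\<in>?P. mtopology closure_of (A p'))"
    using p(2) by (simp add: closure_of_Union)
  then obtain p' where p': "p' \<in> ?P" "q \<in> mtopology closure_of (A p')" by blast
  obtain q' where q': "q' \<in> orbit_of G q" "d q' p \<le> 2 * c"
    using closure_of_shadow[OF A[OF p'(1)] p'(2)] by blast
  have "q' \<in> M"
    using q'(1) partial_homeosD(2)[OF pseudo_star_groupD(1)[OF G]] by (auto simp: orbit_of_def)
  moreover have "p \<in> mball x0 (3 * c)" using p B2 by blast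
  ultimately have "q' \<in> mball x0 (5 * c)"
    using q'(2) triangle[of x0 p q'] commute[of p q'] by auto
  then show False using x0(2) q'(1) by blast
qed

end

section \<open>Periodic orbits and transversals\<close>

text \<open>Finitely many elements of \<open>G\<close> suffice to move all points of \<open>K\<close> into \<open>W\<close>, and each of them is
  injective. With \<open>n\<close> such elements, an orbit has at most \<open>n\<close> times as many points in \<open>K\<close> as in \<open>W\<close>.\<close>
lemma finite_orbit_Int_compact:
  assumes G: "pseudo_star_group X G" and W: "openin X W" "meets_every_orbit X G W"
    and K: "compactin X K" and fin: "finite (orbit_of G x \<inter> W)"
  shows "finite (orbit_of G x \<inter> K)"
proof -
  let ?\<C> = "(\<lambda>g. map_vimage g W) ` G"
  have "openin X V" if "V \<in> ?\<C>" for V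
    using that partial_homeosD(5)[OF pseudo_star_groupD(1)[OF G] W(1)] by auto
  moreover have "K \<subseteq> \<Union>?\<C>"
  proof
    fix z assume "z \<in> K"
    then have "z \<in> topspace X" using compactin_subset_topspace[OF K] by blast
    then obtain g w where "g \<in> G" "g z = Some w" "w \<in> W"
      using W(2) by (fastforce simp: meets_every_orbit_def orbit_of_def)
    then show "z \<in> \<Union>?\<C>" by (auto simp: map_vimage_def)
  qed
  ultimately obtain \<F> where "finite \<F>" "\<F> \<subseteq> ?\<C>" "K \<subseteq> \<Union>\<F>"
    using K unfolding compactin_def by meson
  then obtain H where H: "finite H" "H \<subseteq> G" "K \<subseteq> (\<Union>g\<in>H. map_vimage g W)"
    by (metis finite_subset_image)
  have "orbit_of G x \<inter> K \<subseteq> (\<Union>g\<in>H. map_vimage g (orbit_of G x \<inter> W))"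
  proof
    fix z assume z: "z \<in> orbit_of G x \<inter> K"
    then obtain g w where g: "g \<in> H" "g z = Some w" "w \<in> W"
      using H(3) by (fastforce simp: map_vimage_def)
    then have "w \<in> orbit_of G z" using H(2) by (blast intro: orbit_ofI)
    then have "w \<in> orbit_of G x" using z by (blast intro: orbit_of_trans[OF G])
    then show "z \<in> (\<Union>g\<in>H. map_vimage g (orbit_of G x \<inter> W))"
      using g by (auto simp: map_vimage_def)
  qed
  moreover have "finite (map_vimage g (orbit_of G x \<inter> W))" if "g \<in> H" for g
  proof -
    have inj: "map_inj g"
      using that H(2) by (intro partial_homeosD(3)[OF pseudo_star_groupD(1)[OF G]]) auto
    have "inj_on (\<lambda>z. the (g z)) (map_vimage g (orbit_of G x \<inter> W))"
      using inj by (auto simp: inj_on_def map_vimage_def map_inj_def)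
    moreover have "(\<lambda>z. the (g z)) ` map_vimage g (orbit_of G x \<inter> W) \<subseteq> orbit_of G x \<inter> W"
      by (auto simp: map_vimage_def)
    ultimately show ?thesis using fin by (meson finite_imageD finite_subset)
  qed
  ultimately show ?thesis using H(1) by (meson finite_UN_I finite_subset)
qed

text \<open>The set \<open>W\<close> that witnesses density of periodic orbits is unrelated to \<open>U\<close>. Any open \<open>V\<close> can be moved so as
  to meet \<open>W\<close>, where finite orbits are dense, and finiteness in \<open>W\<close> is then transferred to \<open>K\<close>.\<close>
lemma finite_orbits_dense:
  assumes G: "pseudo_star_group X G" and per: "density_of_periodic_orbits X G"
    and U: "U \<subseteq> K" "compactin X K" and V: "openin X V" "V \<noteq> {}"
  shows "\<exists>p\<in>V. finite (orbit_of G p \<inter> U)"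
proof -
  obtain W where W: "openin X W" "meets_every_orbit X G W"
    and dense: "subtopology X W closure_of
          \<Union>{orbit_of (restrict_pseudogroup G W) x | x.
               x \<in> W \<and> finite (orbit_of (restrict_pseudogroup G W) x)} = W" (is "_ closure_of ?P = W")
    using per unfolding density_of_periodic_orbits_def by blast
  obtain v where v: "v \<in> V" "v \<in> topspace X" using V openin_subset by blast
  then obtain g w where g: "g \<in> G" "g v = Some w" "w \<in> W"
    using W(2) by (fastforce simp: meets_every_orbit_def orbit_of_def)
  let ?N = "map_image g V \<inter> W"
  have N: "openin X ?N" "w \<in> ?N"
    using partial_homeosD(4)[OF pseudo_star_groupD(1)[OF G g(1)] V(1)] W(1) g v
    by (auto simp: map_image_def)
  then have "openin (subtopology X W) ?N" by (auto simp: openin_subtopology)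
  moreover have "w \<in> subtopology X W closure_of ?P" using dense g(3) by simp
  ultimately obtain y where y: "y \<in> ?P" "y \<in> ?N"
    using N(2) unfolding in_closure_of by meson
  then obtain x where x: "x \<in> W" "finite (orbit_of (restrict_pseudogroup G W) x)"
    "y \<in> orbit_of (restrict_pseudogroup G W) x" by blast
  note R = orbit_of_restrict_pseudogroup[OF G W(1) x(1)]
  obtain p where p: "p \<in> V" "g p = Some y" using y(2) by (auto simp: map_image_def)
  have "x \<in> orbit_of G y" using x(3) R orbit_of_sym[OF G] by blast
  then have "x \<in> orbit_of G p" using orbit_of_trans[OF G orbit_ofI[OF g(1) p(2)]] by blast
  then have "p \<in> orbit_of G x" by (rule orbit_of_sym[OF G])
  then have "orbit_of G p \<subseteq> orbit_of G x" using orbit_of_trans[OF G] by blast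
  moreover have "finite (orbit_of G x \<inter> W)" using x(2) R by simp
  ultimately have "finite (orbit_of G p \<inter> W)" by (meson Int_mono finite_subset order_refl)
  from finite_orbit_Int_compact[OF G W U(2) this]
  have "finite (orbit_of G p \<inter> U)" using U(1) by (meson Int_mono finite_subset order_refl)
  with p(1) show ?thesis by blast
qed

text \<open>The points of a finite open set in a \<open>T\<^sub>1\<close> space are isolated, and partial homeomorphisms pull
  isolated points back to isolated points.\<close>
lemma discrete_if_finite_open_transversal:
  assumes G: "pseudo_star_group X G" and t1: "t1_space X"
    and U: "openin X U" "finite U" "meets_every_orbit X G U"
  shows "X = discrete_topology (topspace X)"
proof -
  have "openin X {x}" if x: "x \<in> topspace X" for x
  proof -
    obtain g u where g: "g \<in> G" "g x = Some u" "u \<in> U"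
      using U(3) x by (fastforce simp: meets_every_orbit_def orbit_of_def)
    have "finite (U - {u})" "U - {u} \<subseteq> topspace X"
      using U(2) openin_subset[OF U(1)] by auto
    then have "closedin X (U - {u})"
      using t1[unfolded t1_space_closedin_finite] by blast
    then have "openin X (U - (U - {u}))" using U(1) by (rule openin_diff[rotated])
    moreover have "U - (U - {u}) = {u}" using g(3) by auto
    ultimately have "openin X (map_vimage g {u})"
      using partial_homeosD(5)[OF pseudo_star_groupD(1)[OF G g(1)]] by metis
    moreover have "map_vimage g {u} = {x}"
      using partial_homeosD(3)[OF pseudo_star_groupD(1)[OF G g(1)]] g(2)
      by (auto simp: map_vimage_def map_inj_def)
    ultimately show ?thesis by simp
  qed
  then show ?thesis by (metis discrete_topology_unique)
qed

section \<open>Sensitivity for a metric with finite values\<close>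

text \<open>The open sets on which \<open>g\<close> restricts to an element of \<open>S\<close> cover \<open>dom g\<close>, and a Lebesgue number of this
  cover works for all of \<open>K\<close>.\<close>
lemma (in Metric_space) uniform_local_membership:
  assumes S: "pseudo_star_group mtopology S" and gen: "generates mtopology S G"
    and g: "g \<in> G" and K: "compactin mtopology K" "K \<subseteq> dom g"
  shows "\<exists>e>0. \<forall>a\<in>K. \<exists>V. openin mtopology V \<and> mball a e \<subseteq> V \<and> V \<subseteq> dom g \<and> g |` V \<in> S"
proof -
  let ?\<C> = "{V. openin mtopology V \<and> V \<subseteq> dom g \<and> g |` V \<in> S}"
  have "K \<subseteq> \<Union>?\<C>"
  proof
    fix a assume "a \<in> K"
    then have "a \<in> dom g" using K by blast
    then obtain V where "openin mtopology V" "a \<in> V" "V \<subseteq> dom g" "g |` V \<in> S"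
      using generates_locally_in[OF S gen g] by metis
    then show "a \<in> \<Union>?\<C>" by blast
  qed
  from lebesgue_number[OF K(1) this]
  obtain e where e: "e > 0" "\<And>a. a \<in> K \<Longrightarrow> \<exists>V\<in>?\<C>. mball a e \<subseteq> V"
    by auto
  show ?thesis
  proof (intro exI[of _ e] conjI e(1) ballI)
    fix a assume "a \<in> K"
    from e(2)[OF this] obtain V where "V \<in> ?\<C>" "mball a e \<subseteq> V" by (rule bexE)
    then show "\<exists>V. openin mtopology V \<and> mball a e \<subseteq> V \<and> V \<subseteq> dom g \<and> g |` V \<in> S"
      by (intro exI[of _ V]) simp
  qed
qed

text \<open>Failure of sensitivity at scale \<open>c\<close> for a point and a radius says exactly that the corresponding ball is
  stable around that point. It remains to choose \<open>q\<close>, \<open>x0\<close> and then \<open>c\<close> so that no set is stable.\<close>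
lemma (in Metric_space) compactly_generated_sensitive:
  assumes G: "pseudogroup mtopology G"
    and nondisc: "mtopology \<noteq> discrete_topology M"
    and cg: "compactly_generated mtopology G"
    and trans: "topologically_transitive mtopology G"
    and per: "density_of_periodic_orbits mtopology G"
    and S: "pseudo_star_group mtopology S" "generates mtopology S G"
  shows "\<exists>c>0. \<forall>x\<in>M. \<forall>r>0. \<exists>s\<in>S. \<exists>y. x \<in> dom s \<and> y \<in> dom s \<and>
           d x y < r \<and> c \<le> d (the (s x)) (the (s y))"
proof -
  have Gs: "pseudo_star_group mtopology G" using G by (simp add: pseudogroup_def)
  obtain U F F' ext where U: "openin mtopology U" "compactin mtopology (mtopology closure_of U)"
    and meets: "meets_every_orbit mtopology G U"
    and F: "F \<subseteq> restrict_pseudogroup G U" "finite F" "symmetric_maps F"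
      "generates (subtopology mtopology U) F (restrict_pseudogroup G U)"
    and F': "F' \<subseteq> G" "bij_betw ext F F'"
    and ext: "\<forall>f\<in>F. f \<subseteq>\<^sub>m ext f \<and> mtopology closure_of (dom f) \<subseteq> dom (ext f)"
    using cg unfolding compactly_generated_def by blast
  have UM: "U \<subseteq> M" using openin_subset[OF U(1)] by simp
  have U_closure: "U \<subseteq> mtopology closure_of U" using UM by (simp add: closure_of_subset)
  have t1: "t1_space mtopology"
    by (rule Hausdorff_imp_t1_space[OF Hausdorff_space_mtopology])
  have inf: "infinite U"
    using discrete_if_finite_open_transversal[OF Gs t1 U(1) _ meets] nondisc by auto
  have extG: "ext f \<in> G" if "f \<in> F" for f using that F' by (auto simp: bij_betw_def)
  note periodic = finite_orbits_dense[OF Gs per U_closure U(2)]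
  have "U \<noteq> {}" using inf by auto
  from periodic[OF U(1) this]
  obtain q where q: "q \<in> U" "finite (orbit_of G q \<inter> U)" by blast
  have "\<not> U \<subseteq> orbit_of G q"
  proof
    assume "U \<subseteq> orbit_of G q"
    then have "orbit_of G q \<inter> U = U" by blast
    then show False using q(2) inf by simp
  qed
  then obtain x0 where x0: "x0 \<in> U" "x0 \<notin> orbit_of G q" by blast
  \<comment> \<open>All requirements on \<open>c\<close> concern \<open>q\<close>, \<open>x0\<close> and the generators only, so that the
    same \<open>c\<close> serves at every point of the space.\<close>
  obtain e1 where e1: "e1 > 0" "mball q e1 \<subseteq> U"
    using U(1) q(1) unfolding openin_mtopology by blast
  have "orbit_of G q \<inter> U \<subseteq> topspace mtopology" using UM by auto
  then have "closedin mtopology (orbit_of G q \<inter> U)"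
    using t1[unfolded t1_space_closedin_finite] q(2) by blast
  then have "openin mtopology (U - (orbit_of G q \<inter> U))" using U(1) by (rule openin_diff[rotated])
  moreover have "x0 \<in> U - (orbit_of G q \<inter> U)" using x0 by blast
  ultimately obtain e2 where e2: "e2 > 0" "mball x0 e2 \<subseteq> U - (orbit_of G q \<inter> U)"
    unfolding openin_mtopology by blast
  have "\<exists>e>0. \<forall>a\<in>dom f. \<exists>V. openin mtopology V \<and> mball a e \<subseteq> V \<and> V \<subseteq> dom (ext f) \<and> ext f |` V \<in> S"
    if f: "f \<in> F" for f
  proof -
    have dU: "dom f \<subseteq> U" using F(1) f by (auto simp: restrict_pseudogroup_def)
    then have "compactin mtopology (mtopology closure_of dom f)"
      by (intro closed_compactin[OF U(2)] closure_of_mono) auto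
    from uniform_local_membership[OF S extG[OF f] this] ext f
    obtain e where "e > 0" "\<forall>a\<in>mtopology closure_of dom f.
       \<exists>V. openin mtopology V \<and> mball a e \<subseteq> V \<and> V \<subseteq> dom (ext f) \<and> ext f |` V \<in> S" by meson
    moreover have "dom f \<subseteq> mtopology closure_of dom f"
      using dU UM by (intro closure_of_subset) simp
    ultimately show ?thesis by (meson subsetD)
  qed
  then obtain e where e: "\<And>f. f \<in> F \<Longrightarrow> e f > 0"
    "\<And>f a. f \<in> F \<Longrightarrow> a \<in> dom f \<Longrightarrow> \<exists>V. openin mtopology V \<and> mball a (e f) \<subseteq> V \<and> V \<subseteq> dom (ext f) \<and> ext f |` V \<in> S"
    by metis
  let ?E = "{e1, e2} \<union> e ` F"
  define c where "c = Min ?E / 5"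
  have "finite ?E" using F(2) by simp
  then have "5 * c \<le> v" if "v \<in> ?E" for v
    using Min_le[OF _ that] by (simp only: c_def) simp
  then have c_le: "5 * c \<le> e1" "5 * c \<le> e2" "\<And>f. f \<in> F \<Longrightarrow> 5 * c \<le> e f" by auto
  have "Min ?E \<in> ?E" using \<open>finite ?E\<close> by (intro Min_in) auto
  then have "0 < Min ?E" using e1(1) e2(1) e(1) by (auto simp del: Min_in)
  then have c0: "0 < c" unfolding c_def by (rule divide_pos_pos) simp
  have mono: "mball a r \<subseteq> mball a r'" if "r \<le> r'" for a r r' using that by auto
  interpret shadowing M d G S F ext U c
  proof
    show "\<exists>V. openin mtopology V \<and> mball a (3 * c) \<subseteq> V \<and> V \<subseteq> dom (ext f) \<and> ext f |` V \<in> S"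
      if fa: "f \<in> F" "a \<in> dom f" for f a
    proof -
      obtain V where "openin mtopology V" "mball a (e f) \<subseteq> V" "V \<subseteq> dom (ext f)" "ext f |` V \<in> S"
        using e(2)[OF fa] by blast
      moreover have "mball a (3 * c) \<subseteq> mball a (e f)" using mono c_le(3)[OF fa(1)] c0 by simp
      ultimately show ?thesis by blast
    qed
  qed (use Gs S U F c0 extG ext in auto)
  have "mball q (3 * c) \<subseteq> mball q e1" by (rule mono) (use c_le(1,2) c0 in linarith)
  then have q3: "mball q (3 * c) \<subseteq> U" using e1(2) by blast
  have "mball x0 (5 * c) \<subseteq> mball x0 e2" by (rule mono) (use c_le(1,2) c0 in linarith)
  then have x05: "mball x0 (5 * c) \<subseteq> U - orbit_of G q" using e2(2) by blast
  have unstable: "\<not> stable x B" for x B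
    using q(1) x0(1) UM by (intro not_stable[OF trans meets periodic _ q3 _ x05]) auto
  show ?thesis
  proof (intro exI[of _ c] conjI c0 ballI allI impI)
    fix x and r :: real assume x: "x \<in> M" and r: "0 < r"
    have "\<not> stable x (mball x r)" by (rule unstable)
    then obtain s u v z where s: "s \<in> S" "z \<in> mball x r" "s x = Some u" "s z = Some v" "\<not> d u v < c"
      using x r unfolding stable_def by auto
    then show "\<exists>s\<in>S. \<exists>y. x \<in> dom s \<and> y \<in> dom s \<and> d x y < r \<and> c \<le> d (the (s x)) (the (s y))"
      by (intro bexI[of _ s] exI[of _ z]) auto
  qed
qed

section \<open>Metrics with infinite values\<close>

text \<open>Truncation at \<open>1\<close> turns a metric with infinite values into a real metric with the same small balls.
  The value \<open>0\<close> outside \<open>M\<close> makes the function symmetric and nonnegative everywhere, as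
  \<^locale>\<open>Metric_space\<close> demands.\<close>
definition truncated_metric :: "'a set \<Rightarrow> ('a \<Rightarrow> 'a \<Rightarrow> ennreal) \<Rightarrow> 'a \<Rightarrow> 'a \<Rightarrow> real" where
  "truncated_metric M d x y = (if x \<in> M \<and> y \<in> M then enn2real (min 1 (d x y)) else 0)"

lemma ennreal_truncated_metric:
  "x \<in> M \<Longrightarrow> y \<in> M \<Longrightarrow> ennreal (truncated_metric M d x y) = min 1 (d x y)"
  by (simp add: truncated_metric_def ennreal_enn2real_if min_def)

lemma truncated_metric_less_iff:
  assumes "x \<in> M" "y \<in> M" "r \<le> 1"
  shows "truncated_metric M d x y < r \<longleftrightarrow> d x y < ennreal r"
proof -
  have "truncated_metric M d x y < r \<longleftrightarrow> ennreal (truncated_metric M d x y) < ennreal r"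
    by (subst ennreal_less_iff) (simp_all add: truncated_metric_def)
  also have "\<dots> \<longleftrightarrow> min 1 (d x y) < ennreal r" using assms by (simp add: ennreal_truncated_metric)
  also have "\<dots> \<longleftrightarrow> d x y < ennreal r"
    using assms(3) ennreal_le_1[of r] by (auto simp: min_less_iff_disj)
  finally show ?thesis .
qed

lemma Metric_space_truncated_metric:
  assumes d: "extended_metric_on M d"
  shows "Metric_space M (truncated_metric M d)"
proof
  fix x y z
  show "0 \<le> truncated_metric M d x y" by (simp add: truncated_metric_def)
  show "truncated_metric M d x y = truncated_metric M d y x"
    using d by (simp add: truncated_metric_def extended_metric_on_def)
  show "truncated_metric M d x y = 0 \<longleftrightarrow> x = y" if xy: "x \<in> M" "y \<in> M"
  proof -
    have "truncated_metric M d x y = 0 \<longleftrightarrow> ennreal (truncated_metric M d x y) = 0"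
      by (simp add: truncated_metric_def)
    also have "\<dots> \<longleftrightarrow> d x y = 0"
      using xy by (auto simp: ennreal_truncated_metric min_def)
    finally show ?thesis using d xy by (simp add: extended_metric_on_def)
  qed
  show "truncated_metric M d x z \<le> truncated_metric M d x y + truncated_metric M d y z"
    if xyz: "x \<in> M" "y \<in> M" "z \<in> M"
  proof -
    have "d x z \<le> d x y + d y z" using d xyz unfolding extended_metric_on_def by blast
    then have "min 1 (d x z) \<le> min 1 (d x y) + min 1 (d y z)"
      by (auto simp: min_def add_increasing add_increasing2 intro: order_trans)
    then have "ennreal (truncated_metric M d x z)
        \<le> ennreal (truncated_metric M d x y) + ennreal (truncated_metric M d y z)"
      using xyz by (simp add: ennreal_truncated_metric)
    moreover have nonneg: "0 \<le> truncated_metric M d u v" for u v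
      by (simp add: truncated_metric_def)
    ultimately show ?thesis
      by (simp flip: ennreal_plus)
  qed
qed

text \<open>The balls are given only as a subbase of \<open>X\<close>. The triangle inequality makes each of them open for
  the truncated metric, which gives one inclusion; conversely, small truncated balls are themselves members of
  the subbase.\<close>
lemma mtopology_truncated_metric:
  assumes "compatible_metric X d"
  shows "Metric_space.mtopology (topspace X) (truncated_metric (topspace X) d) = X"
proof -
  let ?M = "topspace X" and ?d = "truncated_metric (topspace X) d"
  let ?B = "{{y \<in> ?M. d x y < ennreal r} | x r. x \<in> ?M \<and> 0 < r}"
  have d: "extended_metric_on ?M d" and X: "X = topology_generated_by ?B"
    using assms by (simp_all add: compatible_metric_def)
  interpret Metric_space ?M ?d by (rule Metric_space_truncated_metric[OF d])
  have ball: "{y \<in> ?M. d x y < ennreal r} = mball x r" if "x \<in> ?M" "r \<le> 1" for x r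
    using that by (auto simp: truncated_metric_less_iff)
  have "openin mtopology {y \<in> ?M. d x y < ennreal r}" if x: "x \<in> ?M" for x r
    unfolding openin_mtopology
  proof (intro conjI allI impI)
    fix y assume y: "y \<in> {y \<in> ?M. d x y < ennreal r}"
    then obtain a where a: "d x y = ennreal a" "0 \<le> a"
      by (cases "d x y") auto
    with y have ar: "a < r" by (simp add: ennreal_less_iff)
    define \<rho> where "\<rho> = min 1 (r - a)"
    have yM: "y \<in> ?M" using y by simp
    have ball_y: "mball y \<rho> = {z \<in> ?M. d y z < ennreal \<rho>}"
      by (rule ball[symmetric, OF yM]) (simp add: \<rho>_def)
    have "mball y \<rho> \<subseteq> {y \<in> ?M. d x y < ennreal r}"
    proof
      fix z assume z: "z \<in> mball y \<rho>"
      then have "z \<in> ?M" "d y z < ennreal \<rho>" unfolding ball_y by simp_all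
      moreover have "d x z \<le> d x y + d y z"
        using d x yM \<open>z \<in> ?M\<close> unfolding extended_metric_on_def by blast
      moreover have "d x y + d y z < ennreal a + ennreal \<rho>"
        using a \<open>d y z < ennreal \<rho>\<close> by (simp add: ennreal_add_left_cancel_less)
      moreover have "ennreal a + ennreal \<rho> \<le> ennreal r"
        using a ar by (simp add: \<rho>_def flip: ennreal_plus)
      ultimately show "z \<in> {y \<in> ?M. d x y < ennreal r}" by auto
    qed
    moreover have "\<rho> > 0" using ar by (simp add: \<rho>_def)
    ultimately show "\<exists>\<rho>>0. mball y \<rho> \<subseteq> {y \<in> ?M. d x y < ennreal r}" by blast
  qed auto
  then have fine: "openin mtopology V" if "openin X V" for V
    using that generate_topology_on_coarsest[OF istopology_openin, of ?B mtopology V]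
    by (subst (asm) X) (auto simp: openin_topology_generated_by_iff)
  have coarse: "openin X V" if V: "openin mtopology V" for V
  proof (subst openin_subopen, intro ballI)
    fix x assume x: "x \<in> V"
    then have xM: "x \<in> ?M" using openin_subset[OF V] by auto
    obtain r where r: "r > 0" "mball x r \<subseteq> V" using V x unfolding openin_mtopology by blast
    have "mball x (min 1 r) \<in> ?B"
      using ball[OF xM, of "min 1 r"] xM r(1) by (auto intro!: exI[of _ x] exI[of _ "min 1 r"])
    then have "openin X (mball x (min 1 r))"
      by (subst X) (rule topology_generated_by_Basis)
    moreover have "x \<in> mball x (min 1 r)" using xM r(1) by simp
    moreover have "mball x (min 1 r) \<subseteq> V" using r(2) by auto
    ultimately show "\<exists>T. openin X T \<and> x \<in> T \<and> T \<subseteq> V" by blast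
  qed
  show ?thesis unfolding topology_eq using fine coarse by blast
qed

section \<open>Sensitivity to initial conditions\<close>

text \<open>A sensitivity constant for the truncated metric also serves for \<open>d\<close>, because truncation only
  decreases distances and preserves those below \<open>1\<close>.\<close>
theorem theorem1p11:
  fixes X :: "'a topology" and G :: "('a \<rightharpoonup> 'a) set"
  assumes "polish_topology X"
    and "topspace X = {} \<or> X \<noteq> discrete_topology (topspace X)"
    and "pseudogroup X G"
    and "compactly_generated X G"
    and "topologically_transitive X G"
    and "density_of_periodic_orbits X G"
  shows "sensitive_to_initial_conditions X G"
  unfolding sensitive_to_initial_conditions_def
proof (intro allI impI)
  fix d S
  assume dS: "compatible_metric X d \<and> pseudo_star_group X S \<and> S \<subseteq> G \<and> generates X S G"
  let ?M = "topspace X" and ?d = "truncated_metric (topspace X) d"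
  show "\<exists>c::real. 0 < c \<and> (\<forall>x\<in>?M. \<forall>r::real. 0 < r \<longrightarrow>
          (\<exists>s\<in>S. \<exists>y. x \<in> dom s \<and> y \<in> dom s \<and> d x y < ennreal r \<and>
             ennreal c \<le> d (the (s x)) (the (s y))))"
  proof (cases "?M = {}")
    case True
    then show ?thesis by (intro exI[of _ 1]) simp
  next
    case False
    interpret Metric_space ?M ?d
      by (rule Metric_space_truncated_metric) (use dS in \<open>simp add: compatible_metric_def\<close>)
    have X: "mtopology = X" using dS by (simp add: mtopology_truncated_metric)
    have nondiscrete: "X \<noteq> discrete_topology ?M" using assms(2) False by blast
    have S: "pseudo_star_group X S" "generates X S G" using dS by simp_all
    from compactly_generated_sensitive[unfolded X, OF assms(3) nondiscrete assms(4-6) S]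
    obtain c where c: "c > 0" and sens: "\<And>x r. x \<in> ?M \<Longrightarrow> r > 0 \<Longrightarrow>
        \<exists>s\<in>S. \<exists>y. x \<in> dom s \<and> y \<in> dom s \<and> ?d x y < r \<and> c \<le> ?d (the (s x)) (the (s y))"
      by meson
    show ?thesis
    proof (intro exI[of _ c] conjI c ballI allI impI)
      fix x and r :: real assume x: "x \<in> ?M" and r: "0 < r"
      obtain s y where s: "s \<in> S" "x \<in> dom s" "y \<in> dom s" "?d x y < min 1 r"
        "c \<le> ?d (the (s x)) (the (s y))"
        using sens[OF x, of "min 1 r"] r by auto
      have ph: "s \<in> partial_homeos X" by (rule pseudo_star_groupD(1)[OF S(1) s(1)])
      have "y \<in> ?M" using partial_homeosD(1)[OF ph] s(3) by blast
      have "d x y < ennreal (min 1 r)"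
        by (rule truncated_metric_less_iff[THEN iffD1, OF x \<open>y \<in> ?M\<close> _ s(4)]) simp
      also have "\<dots> \<le> ennreal r" by (rule ennreal_leI) simp
      finally have "d x y < ennreal r" .
      moreover have "ennreal c \<le> d (the (s x)) (the (s y))"
      proof -
        have "the (s x) \<in> ?M" "the (s y) \<in> ?M" using partial_homeosD(2)[OF ph] s(2,3) by auto
        then have "ennreal (?d (the (s x)) (the (s y))) \<le> d (the (s x)) (the (s y))"
          by (simp add: ennreal_truncated_metric)
        then show ?thesis using ennreal_leI[OF s(5)] by (rule order_trans[rotated])
      qed
      ultimately show "\<exists>s\<in>S. \<exists>y. x \<in> dom s \<and> y \<in> dom s \<and> d x y < ennreal r \<and>
             ennreal c \<le> d (the (s x)) (the (s y))"
        using s(1-3) by blast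
    qed
  qed
qed

end
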